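(* Let $K$ be a field and let $q\in K$ be a nonzero element which is not a root of unity. Let $B=B(q)$ be the $K$-algebra generated by $a,b$ subject to the relation $ab=q\,ba$. Consider the left ideals $I=B(ab-1)(a-1)\subset J=B(a-1)$ of $B$, and the left $B$-modules $M=B/I$, $V=J/I\subseteq M$ and $W=B/J$. Then: (a) $V$ is a simple $B$-module, and $M$ is a non-Artinian essential extension of its submodule $V$; (b) the submodules of $W$ are linearly ordered by inclusion, and are pairwise non-isomorphic.
   Context: $B(q)$ is the coordinate algebra of the quantum plane. Modules are left modules. *)

theory Defs
  imports "HOL-Algebra.QuotRing" "HOL-Algebra.Module"
begin

section \<open>Left modules over a not necessarily commutative ring\<close>

text \<open>
  The locale \<^locale>\<open>module\<close> requires a commutative ring of scalars.  The record type of modules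
  and the locale \<^locale>\<open>submodule\<close> do not, and are reused here; the record fields
  for multiplication and unit play no role for a module.
\<close>

locale left_module = R?: ring R + M?: abelian_group M
  for R :: "('a, 'c) ring_scheme" (structure) and M :: "('a, 'b, 'd) module_scheme" (structure) +
  assumes smult_closed [simp, intro]:
      "\<lbrakk>r \<in> carrier R; x \<in> carrier M\<rbrakk> \<Longrightarrow> r \<odot>\<^bsub>M\<^esub> x \<in> carrier M"
    and smult_l_distr:
      "\<lbrakk>r \<in> carrier R; s \<in> carrier R; x \<in> carrier M\<rbrakk> \<Longrightarrow>
        (r \<oplus> s) \<odot>\<^bsub>M\<^esub> x = r \<odot>\<^bsub>M\<^esub> x \<oplus>\<^bsub>M\<^esub> s \<odot>\<^bsub>M\<^esub> x"
    and smult_r_distr: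
      "\<lbrakk>r \<in> carrier R; x \<in> carrier M; y \<in> carrier M\<rbrakk> \<Longrightarrow>
        r \<odot>\<^bsub>M\<^esub> (x \<oplus>\<^bsub>M\<^esub> y) = r \<odot>\<^bsub>M\<^esub> x \<oplus>\<^bsub>M\<^esub> r \<odot>\<^bsub>M\<^esub> y"
    and smult_assoc:
      "\<lbrakk>r \<in> carrier R; s \<in> carrier R; x \<in> carrier M\<rbrakk> \<Longrightarrow>
        (r \<otimes> s) \<odot>\<^bsub>M\<^esub> x = r \<odot>\<^bsub>M\<^esub> (s \<odot>\<^bsub>M\<^esub> x)"
    and smult_one [simp]: "x \<in> carrier M \<Longrightarrow> \<one> \<odot>\<^bsub>M\<^esub> x = x"

definition regular_module :: "('a, 'c) ring_scheme \<Rightarrow> ('a, 'a) module" where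
  "regular_module R =
    \<lparr>carrier = carrier R, mult = mult R, one = one R, zero = zero R, add = add R,
     smult = mult R\<rparr>"

definition principal_left_ideal :: "('a, 'c) ring_scheme \<Rightarrow> 'a \<Rightarrow> 'a set" where
  "principal_left_ideal R x = {r \<otimes>\<^bsub>R\<^esub> x | r. r \<in> carrier R}"

text \<open>
  The quotient of a module by a submodule \<open>N\<close>, with the cosets of \<open>N\<close> as elements.
  As for \<^const>\<open>rcoset_mult\<close>, all representatives of a coset are used in the scalar
  multiplication, which avoids a choice.
\<close>

definition quotient_module :: "('a, 'b, 'd) module_scheme \<Rightarrow> 'b set \<Rightarrow> ('a, 'b set) module" where
  "quotient_module M N =
    \<lparr>carrier = a_rcosets\<^bsub>M\<^esub> N, mult = undefined, one = undefined, zero = N, add = set_add M,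
     smult = (\<lambda>r X. \<Union>x\<in>X. N +>\<^bsub>M\<^esub> (r \<odot>\<^bsub>M\<^esub> x))\<rparr>"

definition simple_module :: "('a, 'c) ring_scheme \<Rightarrow> ('a, 'b, 'd) module_scheme \<Rightarrow> bool" where
  "simple_module R M \<longleftrightarrow>
    left_module R M \<and> carrier M \<noteq> {\<zero>\<^bsub>M\<^esub>} \<and>
    (\<forall>N. submodule N R M \<longrightarrow> N = {\<zero>\<^bsub>M\<^esub>} \<or> N = carrier M)"

definition artinian_module :: "('a, 'c) ring_scheme \<Rightarrow> ('a, 'b, 'd) module_scheme \<Rightarrow> bool" where
  "artinian_module R M \<longleftrightarrow>
    (\<forall>S :: nat \<Rightarrow> 'b set. (\<forall>n. submodule (S n) R M) \<and> (\<forall>n. S (Suc n) \<subseteq> S n) \<longrightarrow>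
      (\<exists>n. \<forall>m\<ge>n. S m = S n))"

text \<open>\<open>essential_extension R M V\<close>: the module \<open>M\<close> is an essential extension of its submodule \<open>V\<close>.\<close>

definition essential_extension ::
    "('a, 'c) ring_scheme \<Rightarrow> ('a, 'b, 'd) module_scheme \<Rightarrow> 'b set \<Rightarrow> bool" where
  "essential_extension R M V \<longleftrightarrow>
    left_module R M \<and> submodule V R M \<and>
    (\<forall>N. submodule N R M \<and> N \<noteq> {\<zero>\<^bsub>M\<^esub>} \<longrightarrow> N \<inter> V \<noteq> {\<zero>\<^bsub>M\<^esub>})"

definition module_hom ::
    "('a, 'c) ring_scheme \<Rightarrow> ('a, 'b, 'd) module_scheme \<Rightarrow> ('a, 'e, 'f) module_scheme
      \<Rightarrow> ('b \<Rightarrow> 'e) set" where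
  "module_hom R M N =
    {f. f \<in> carrier M \<rightarrow> carrier N \<and>
        (\<forall>x\<in>carrier M. \<forall>y\<in>carrier M. f (x \<oplus>\<^bsub>M\<^esub> y) = f x \<oplus>\<^bsub>N\<^esub> f y) \<and>
        (\<forall>r\<in>carrier R. \<forall>x\<in>carrier M. f (r \<odot>\<^bsub>M\<^esub> x) = r \<odot>\<^bsub>N\<^esub> f x)}"

definition isomorphic_modules ::
    "('a, 'c) ring_scheme \<Rightarrow> ('a, 'b, 'd) module_scheme \<Rightarrow> ('a, 'e, 'f) module_scheme \<Rightarrow> bool" where
  "isomorphic_modules R M N \<longleftrightarrow>
    (\<exists>f \<in> module_hom R M N. bij_betw f (carrier M) (carrier N))"

lemma left_module_regular_module:
  fixes R (structure)
  assumes "ring R"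
  shows "left_module R (regular_module R)"
proof -
  interpret ring R by fact
  have "abelian_group (regular_module R)"
    by (rule abelian_groupI)
      (auto simp: regular_module_def a_ac intro: a_inv_closed l_neg bexI[of _ "\<ominus> x" for x])
  then show ?thesis
    by (auto intro!: left_module.intro left_module_axioms.intro ring_axioms
        simp: regular_module_def l_distr r_distr m_assoc)
qed

lemma principal_left_ideal_submodule:
  fixes R (structure)
  assumes "ring R" and x: "x \<in> carrier R"
  shows "submodule (principal_left_ideal R x) R (regular_module R)"
proof -
  interpret ring R by fact
  interpret L: left_module R "regular_module R"
    by (rule left_module_regular_module) fact
  have inv: "inv\<^bsub>add_monoid (regular_module R)\<^esub> y = \<ominus> y" if "y \<in> carrier R" for y
    by (simp add: a_inv_def regular_module_def m_inv_def)
  show ?thesis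
  proof (intro submodule.intro submodule_axioms.intro L.add.subgroupI)
    show "principal_left_ideal R x \<subseteq> carrier (regular_module R)"
      using x by (auto simp: principal_left_ideal_def regular_module_def)
    show "principal_left_ideal R x \<noteq> {}"
      by (auto simp: principal_left_ideal_def)
    show "\<ominus>\<^bsub>regular_module R\<^esub> y \<in> principal_left_ideal R x"
      if "y \<in> principal_left_ideal R x" for y
    proof -
      from that obtain r where r: "r \<in> carrier R" "y = r \<otimes> x"
        by (auto simp: principal_left_ideal_def)
      then have "\<ominus>\<^bsub>regular_module R\<^esub> y = (\<ominus> r) \<otimes> x"
        using x inv[of y] by (simp add: a_inv_def[of "regular_module R"] l_minus)
      then show ?thesis
        using r unfolding principal_left_ideal_def by blast
    qed
    show "y \<oplus>\<^bsub>regular_module R\<^esub> z \<in> principal_left_ideal R x"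
      if "y \<in> principal_left_ideal R x" "z \<in> principal_left_ideal R x" for y z
      using that x unfolding principal_left_ideal_def
      by (auto simp: regular_module_def l_distr[symmetric])
    show "r \<odot>\<^bsub>regular_module R\<^esub> y \<in> principal_left_ideal R x"
      if "r \<in> carrier R" "y \<in> principal_left_ideal R x" for r y
      using that x unfolding principal_left_ideal_def
      by (auto simp: regular_module_def m_assoc[symmetric])
  qed
qed

lemma left_module_quotient_module:
  assumes "left_module R M" and N: "submodule N R M"
  shows "left_module R (quotient_module M N)"
proof -
  interpret left_module R M by fact
  interpret N: submodule N R M by fact
  interpret A: abelian_subgroup N M
    by (rule abelian_subgroupI3)
      (auto intro: additive_subgroupI N.subgroup_axioms M.abelian_group_axioms)
  have smult: "r \<odot>\<^bsub>quotient_module M N\<^esub> (N +>\<^bsub>M\<^esub> x) = N +>\<^bsub>M\<^esub> (r \<odot>\<^bsub>M\<^esub> x)"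
    if r: "r \<in> carrier R" and x: "x \<in> carrier M" for r x
  proof -
    have eq: "N +>\<^bsub>M\<^esub> (r \<odot>\<^bsub>M\<^esub> y) = N +>\<^bsub>M\<^esub> (r \<odot>\<^bsub>M\<^esub> x)" if y: "y \<in> N +>\<^bsub>M\<^esub> x" for y
    proof -
      from y obtain n where n: "n \<in> N" "y = n \<oplus>\<^bsub>M\<^esub> x"
        by (auto simp: a_r_coset_def')
      then have "r \<odot>\<^bsub>M\<^esub> y = r \<odot>\<^bsub>M\<^esub> n \<oplus>\<^bsub>M\<^esub> r \<odot>\<^bsub>M\<^esub> x"
        using smult_r_distr[OF r A.a_Hcarr[OF n(1)] x] by simp
      then have "r \<odot>\<^bsub>M\<^esub> y \<in> N +>\<^bsub>M\<^esub> (r \<odot>\<^bsub>M\<^esub> x)"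
        using N.smult_closed[OF r n(1)] unfolding a_r_coset_def' by blast
      from M.a_repr_independence[OF this smult_closed[OF r x] N.subgroup_axioms]
      show ?thesis by simp
    qed
    have "r \<odot>\<^bsub>quotient_module M N\<^esub> (N +>\<^bsub>M\<^esub> x)
        = (\<Union>y\<in>N +>\<^bsub>M\<^esub> x. N +>\<^bsub>M\<^esub> (r \<odot>\<^bsub>M\<^esub> y))"
      by (simp add: quotient_module_def)
    also have "\<dots> = (\<Union>y\<in>N +>\<^bsub>M\<^esub> x. N +>\<^bsub>M\<^esub> (r \<odot>\<^bsub>M\<^esub> x))"
      by (rule SUP_cong[OF refl eq])
    also have "\<dots> = N +>\<^bsub>M\<^esub> (r \<odot>\<^bsub>M\<^esub> x)"
      using A.a_rcos_self[OF x] by blast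
    finally show ?thesis .
  qed
  have car: "carrier (quotient_module M N) = {N +>\<^bsub>M\<^esub> x | x. x \<in> carrier M}"
    by (auto simp: quotient_module_def A_RCOSETS_def')
  have add: "(N +>\<^bsub>M\<^esub> x) \<oplus>\<^bsub>quotient_module M N\<^esub> (N +>\<^bsub>M\<^esub> y) = N +>\<^bsub>M\<^esub> (x \<oplus>\<^bsub>M\<^esub> y)"
    if "x \<in> carrier M" "y \<in> carrier M" for x y
    using that by (simp add: quotient_module_def A.a_rcos_sum)
  have zero: "\<zero>\<^bsub>quotient_module M N\<^esub> = N +>\<^bsub>M\<^esub> \<zero>\<^bsub>M\<^esub>"
    using A.a_subset by (simp add: quotient_module_def)
  have "abelian_group (quotient_module M N)"
  proof (rule abelian_groupI)
    show "\<exists>Y\<in>carrier (quotient_module M N). Y \<oplus>\<^bsub>quotient_module M N\<^esub> X = \<zero>\<^bsub>quotient_module M N\<^esub>"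
      if "X \<in> carrier (quotient_module M N)" for X
    proof -
      from that obtain x where x: "x \<in> carrier M" "X = N +>\<^bsub>M\<^esub> x"
        by (auto simp: car)
      then have "(N +>\<^bsub>M\<^esub> (\<ominus>\<^bsub>M\<^esub> x)) \<oplus>\<^bsub>quotient_module M N\<^esub> X = \<zero>\<^bsub>quotient_module M N\<^esub>"
        by (simp add: add zero M.l_neg)
      moreover have "N +>\<^bsub>M\<^esub> (\<ominus>\<^bsub>M\<^esub> x) \<in> carrier (quotient_module M N)"
        using x by (auto simp: car)
      ultimately show ?thesis by blast
    qed
    show "X \<oplus>\<^bsub>quotient_module M N\<^esub> Y = Y \<oplus>\<^bsub>quotient_module M N\<^esub> X"
      if XY: "X \<in> carrier (quotient_module M N)" "Y \<in> carrier (quotient_module M N)" for X Y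
    proof -
      from XY obtain x y where "x \<in> carrier M" "X = N +>\<^bsub>M\<^esub> x" "y \<in> carrier M" "Y = N +>\<^bsub>M\<^esub> y"
        by (auto simp: car)
      then show ?thesis
        by (simp add: add M.a_comm[of x y])
    qed
  qed (auto simp: car add zero M.a_assoc)
  show ?thesis
    by (intro left_module.intro left_module_axioms.intro ring_axioms)
      (use \<open>abelian_group (quotient_module M N)\<close> in
        \<open>auto simp: car smult add smult_l_distr smult_r_distr smult_assoc\<close>)
qed


section \<open>The quantum plane\<close>

text \<open>
  The free associative algebra on a set of generators over a field: finitely supported functions on
  words, with the convolution product.
\<close>

definition free_algebra :: "('x list \<Rightarrow> 'k::field) ring" where
  "free_algebra =
    \<lparr>carrier = {f. finite {w. f w \<noteq> 0}},
     mult = (\<lambda>f g w. \<Sum>i\<le>length w. f (take i w) * g (drop i w)),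
     one = (\<lambda>w. if w = [] then 1 else 0),
     zero = (\<lambda>w. 0),
     add = (\<lambda>f g w. f w + g w)\<rparr>"

definition monomial :: "'k::field \<Rightarrow> 'x list \<Rightarrow> 'x list \<Rightarrow> 'k" where
  "monomial c w = (\<lambda>v. if v = w then c else 0)"

datatype qp_gen = Gen_a | Gen_b

definition qp_ideal :: "'k::field \<Rightarrow> (qp_gen list \<Rightarrow> 'k) set" where
  "qp_ideal q =
    Idl\<^bsub>free_algebra\<^esub> {monomial 1 [Gen_a, Gen_b] \<ominus>\<^bsub>free_algebra\<^esub> monomial q [Gen_b, Gen_a]}"

definition quantum_plane :: "'k::field \<Rightarrow> (qp_gen list \<Rightarrow> 'k) set ring" where
  "quantum_plane q = free_algebra Quot qp_ideal q"

definition qp_a :: "'k::field \<Rightarrow> (qp_gen list \<Rightarrow> 'k) set" where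
  "qp_a q = qp_ideal q +>\<^bsub>free_algebra\<^esub> monomial 1 [Gen_a]"

definition qp_b :: "'k::field \<Rightarrow> (qp_gen list \<Rightarrow> 'k) set" where
  "qp_b q = qp_ideal q +>\<^bsub>free_algebra\<^esub> monomial 1 [Gen_b]"

lemma ring_free_algebra: "ring (free_algebra :: ('x list \<Rightarrow> 'k::field) ring)"
proof (rule ringI)
  let ?F = "free_algebra :: ('x list \<Rightarrow> 'k) ring"
  have fin_add: "finite {w. f w + g w \<noteq> 0}"
    if "finite {w. f w \<noteq> 0}" "finite {w. g w \<noteq> 0}" for f g :: "'x list \<Rightarrow> 'k"
    by (rule finite_subset[OF _ finite_UnI[OF that]]) auto
  show "abelian_group ?F"
  proof (rule abelian_groupI)
    show "\<exists>g\<in>carrier ?F. g \<oplus>\<^bsub>?F\<^esub> f = \<zero>\<^bsub>?F\<^esub>" if "f \<in> carrier ?F" for f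
      using that by (intro bexI[of _ "\<lambda>w. - f w"]) (auto simp: free_algebra_def)
  qed (auto simp: free_algebra_def fin_add ac_simps)
  show "monoid ?F"
  proof (rule monoidI)
    fix f g h
    assume f: "f \<in> carrier ?F" and g: "g \<in> carrier ?F"
    show "f \<otimes>\<^bsub>?F\<^esub> g \<in> carrier ?F"
    proof -
      have "{w. (\<Sum>i\<le>length w. f (take i w) * g (drop i w)) \<noteq> 0}
          \<subseteq> (\<lambda>(u, v). u @ v) ` ({w. f w \<noteq> 0} \<times> {w. g w \<noteq> 0})"
      proof safe
        fix w assume "(\<Sum>i\<le>length w. f (take i w) * g (drop i w)) \<noteq> 0"
        then obtain i where "f (take i w) * g (drop i w) \<noteq> 0"
          by (meson sum.neutral)
        then show "w \<in> (\<lambda>(u, v). u @ v) ` ({w. f w \<noteq> 0} \<times> {w. g w \<noteq> 0})"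
          by (intro image_eqI[of _ _ "(take i w, drop i w)"]) auto
      qed
      then have "finite {w. (\<Sum>i\<le>length w. f (take i w) * g (drop i w)) \<noteq> 0}"
        by (rule finite_subset) (use f g in \<open>auto simp: free_algebra_def\<close>)
      then show ?thesis
        by (simp add: free_algebra_def)
    qed
    have "(\<Sum>i\<le>length w. (\<Sum>j\<le>length (take i w). f (take j (take i w)) * g (drop j (take i w)))
              * h (drop i w))
        = (\<Sum>i\<le>length w. f (take i w) *
            (\<Sum>j\<le>length (drop i w). g (take j (drop i w)) * h (drop j (drop i w))))" for w
    proof -
      let ?n = "length w"
      let ?t = "\<lambda>i j. f (take i w) * g (take j (drop i w)) * h (drop (j + i) w)"
      have "(\<Sum>i\<le>?n. (\<Sum>j\<le>length (take i w). f (take j (take i w)) * g (drop j (take i w)))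
                * h (drop i w))
          = (\<Sum>i\<le>?n. \<Sum>j\<le>i. ?t j (i - j))"
        by (intro sum.cong refl)
          (auto simp: sum_distrib_right min_def drop_take intro!: sum.cong)
      also have "\<dots> = (\<Sum>(i, j)\<in>(SIGMA i:{..?n}. {..i}). ?t j (i - j))"
        by (rule sum.Sigma) auto
      also have "\<dots> = (\<Sum>(i, j)\<in>(SIGMA i:{..?n}. {..?n - i}). ?t i j)"
        by (rule sum.reindex_bij_witness[where i = "\<lambda>(i, j). (i + j, i)"
              and j = "\<lambda>(i, j). (j, i - j)"]) auto
      also have "\<dots> = (\<Sum>i\<le>?n. \<Sum>j\<le>?n - i. ?t i j)"
        by (simp add: sum.Sigma)
      also have "\<dots> = (\<Sum>i\<le>?n. f (take i w) *
            (\<Sum>j\<le>length (drop i w). g (take j (drop i w)) * h (drop j (drop i w))))"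
        by (simp add: sum_distrib_left mult.assoc)
      finally show ?thesis .
    qed
    then show "f \<otimes>\<^bsub>?F\<^esub> g \<otimes>\<^bsub>?F\<^esub> h = f \<otimes>\<^bsub>?F\<^esub> (g \<otimes>\<^bsub>?F\<^esub> h)"
      by (simp add: free_algebra_def fun_eq_iff)
    have "(\<Sum>i\<le>length w. (if take i w = [] then 1 else 0) * f (drop i w)) = f w" for w
    proof -
      have "(\<Sum>i\<le>length w. (if take i w = [] then 1 else 0) * f (drop i w))
          = (\<Sum>i\<le>length w. if i = 0 then f w else 0)"
        by (intro sum.cong) auto
      then show ?thesis by simp
    qed
    then show "\<one>\<^bsub>?F\<^esub> \<otimes>\<^bsub>?F\<^esub> f = f"
      by (simp add: free_algebra_def)
    have "(\<Sum>i\<le>length w. f (take i w) * (if drop i w = [] then 1 else 0)) = f w" for w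
    proof -
      have "(\<Sum>i\<le>length w. f (take i w) * (if drop i w = [] then 1 else 0))
          = (\<Sum>i\<le>length w. if i = length w then f w else 0)"
        by (intro sum.cong) auto
      then show ?thesis by simp
    qed
    then show "f \<otimes>\<^bsub>?F\<^esub> \<one>\<^bsub>?F\<^esub> = f"
      by (simp add: free_algebra_def)
  qed (auto simp: free_algebra_def)
qed (auto simp: free_algebra_def fun_eq_iff algebra_simps sum.distrib)

lemma monomial_closed: "monomial c w \<in> carrier free_algebra"
proof -
  have "finite {v. v = w \<and> c \<noteq> 0}"
    by (rule finite_subset[of _ "{w}"]) auto
  then show ?thesis
    by (auto simp: monomial_def free_algebra_def)
qed

lemma monomial_mult:
  "monomial c v \<otimes>\<^bsub>free_algebra\<^esub> monomial d w = monomial (c * d) (v @ w)"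
proof -
  have "(\<Sum>i\<le>length u. monomial c v (take i u) * monomial d w (drop i u))
      = monomial (c * d) (v @ w) u" for u
  proof (cases "u = v @ w")
    case True
    have "(\<Sum>i\<le>length u. monomial c v (take i u) * monomial d w (drop i u))
        = (\<Sum>i\<le>length u. if i = length v then c * d else 0)"
    proof (intro sum.cong refl)
      fix i assume "i \<in> {..length u}"
      then have "take i u = v \<longleftrightarrow> i = length v"
        using True by (metis append_eq_conv_conj atMost_iff length_take min.absorb2)
      then show "monomial c v (take i u) * monomial d w (drop i u)
          = (if i = length v then c * d else 0)"
        using True by (auto simp: monomial_def)
    qed
    then show ?thesis
      using True by (simp add: monomial_def)
  next
    case False
    then have "monomial c v (take i u) * monomial d w (drop i u) = 0" for i
      by (metis append_take_drop_id monomial_def mult_eq_0_iff)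
    then have "(\<Sum>i\<le>length u. monomial c v (take i u) * monomial d w (drop i u)) = 0"
      by (simp only: sum.neutral_const)
    then show ?thesis
      using False by (simp add: monomial_def)
  qed
  then show ?thesis
    by (simp add: free_algebra_def)
qed

lemma ideal_qp_ideal: "ideal (qp_ideal q) free_algebra"
proof -
  interpret ring "free_algebra :: (qp_gen list \<Rightarrow> 'a) ring" by (rule ring_free_algebra)
  show ?thesis
    unfolding qp_ideal_def by (intro genideal_ideal) (simp add: monomial_closed)
qed

lemma ring_quantum_plane: "ring (quantum_plane q)"
  unfolding quantum_plane_def by (intro ideal.quotient_is_ring ideal_qp_ideal)

text \<open>
  The defining relation, where the scalar $q$ of the ground field is the class of the
  constant \<open>monomial q []\<close>.
\<close>

lemma quantum_plane_relation:
  "qp_a q \<otimes>\<^bsub>quantum_plane q\<^esub> qp_b q =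
    (qp_ideal q +>\<^bsub>free_algebra\<^esub> monomial q []) \<otimes>\<^bsub>quantum_plane q\<^esub>
      (qp_b q \<otimes>\<^bsub>quantum_plane q\<^esub> qp_a q)"
proof -
  interpret ideal "qp_ideal q" free_algebra by (rule ideal_qp_ideal)
  let ?F = "free_algebra :: (qp_gen list \<Rightarrow> 'a) ring"
  let ?x = "monomial 1 [Gen_a, Gen_b] :: qp_gen list \<Rightarrow> 'a"
  let ?y = "monomial q [Gen_b, Gen_a]"
  have "?x \<ominus>\<^bsub>?F\<^esub> ?y \<in> qp_ideal q"
    unfolding qp_ideal_def by (rule genideal_self') (simp add: monomial_closed)
  then have "qp_ideal q +>\<^bsub>?F\<^esub> ?x = qp_ideal q +>\<^bsub>?F\<^esub> ?y"
    using quotient_eq_iff_same_a_r_cos[OF ideal_axioms] by (simp add: monomial_closed)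
  then show ?thesis
    by (simp add: quantum_plane_def qp_a_def qp_b_def FactRing_def rcoset_mult_add
        monomial_closed monomial_mult)
qed

end

(*
  W has the basis b^n on which a acts diagonally with the distinct eigenvalues q^n, so a submodule
  contains every b^k occurring in one of its elements and is thus of the form b^n K[b]; a
  homomorphism between submodules multiplies each eigenvector b^n by a scalar, so isomorphic
  submodules are equal.  V is generated by the class e_0 of a - 1, which is fixed by ab, and has a
  basis (e_j), j an integer, of eigenvectors of ab with eigenvalues q^j that are permuted up to
  scalars by a and b; hence V is simple.  A nonzero submodule N of M with zero intersection with V
  embeds in M/V = W and therefore contains some b^n + v with v in V and a (b^n + v) = q^n (b^n + v),
  which has no solution v of finite support.  That these elements are linearly independent is seen
  by letting B act on functions on the index sets.
*)

theory Submission
  imports Defs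
begin

section \<open>Left modules\<close>

text \<open>The algebra is given only by generators and a relation, and no normal form of its
  elements is at hand, so nothing in M or W is known to be nonzero in advance. Spanning and
  independence are therefore obtained separately. The relations show that a candidate family spans
  the cyclic module B/Bz. A homomorphism from B/Bz to a function module amounts to a vector v with z
  v = 0, and v is chosen so that the family goes to the delta functions. Both together turn the
  homomorphism into a coordinate map, and from then on only coordinates are compared. The formulas
  for M are forced. With w the class of 1, the relations ab = q ba and a w = w + e_0 give a b^n w =
  q^n (b^n w + e_n), while ab e_0 = e_0 and b e_j = e_(j+1) give a e_(j+1) = q^j e_j. M is not
  Artinian because its quotient W is not: the preimages of b^n K[b] descend strictly.\<close>

lemma (in abelian_group) minus_eq_zero_iff:
  assumes "x \<in> carrier G" "y \<in> carrier G"
  shows "x \<ominus> y = \<zero> \<longleftrightarrow> x = y"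
proof
  assume "x \<ominus> y = \<zero>"
  then have "x \<oplus> \<ominus> y = y \<oplus> \<ominus> y"
    using assms by (simp add: a_minus_def r_neg)
  then show "x = y"
    using assms by (metis a_inv_closed add.right_cancel)
qed (use assms in \<open>simp add: a_minus_def r_neg\<close>)

context left_module
begin

lemma smult_zero_right [simp]: "r \<in> carrier R \<Longrightarrow> r \<odot>\<^bsub>M\<^esub> \<zero>\<^bsub>M\<^esub> = \<zero>\<^bsub>M\<^esub>"
  using smult_r_distr[of r "\<zero>\<^bsub>M\<^esub>" "\<zero>\<^bsub>M\<^esub>"] by simp

lemma smult_zero_left [simp]: "x \<in> carrier M \<Longrightarrow> \<zero> \<odot>\<^bsub>M\<^esub> x = \<zero>\<^bsub>M\<^esub>"
  using smult_l_distr[of "\<zero>" "\<zero>" x] by simp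

lemma smult_minus_left:
  assumes "r \<in> carrier R" "x \<in> carrier M"
  shows "(\<ominus> r) \<odot>\<^bsub>M\<^esub> x = \<ominus>\<^bsub>M\<^esub> (r \<odot>\<^bsub>M\<^esub> x)"
proof -
  have "(\<ominus> r) \<odot>\<^bsub>M\<^esub> x \<oplus>\<^bsub>M\<^esub> r \<odot>\<^bsub>M\<^esub> x = \<zero>\<^bsub>M\<^esub>"
    using assms by (simp flip: smult_l_distr add: R.l_neg)
  then show ?thesis
    using assms by (metis M.minus_equality R.a_inv_closed smult_closed)
qed

lemma smult_diff_left:
  assumes "r \<in> carrier R" "s \<in> carrier R" "x \<in> carrier M"
  shows "(r \<ominus> s) \<odot>\<^bsub>M\<^esub> x = r \<odot>\<^bsub>M\<^esub> x \<ominus>\<^bsub>M\<^esub> s \<odot>\<^bsub>M\<^esub> x"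
  using assms by (simp add: a_minus_def smult_l_distr smult_minus_left)

lemma submoduleI:
  assumes "N \<subseteq> carrier M" "\<zero>\<^bsub>M\<^esub> \<in> N"
    and add: "\<And>x y. \<lbrakk>x \<in> N; y \<in> N\<rbrakk> \<Longrightarrow> x \<oplus>\<^bsub>M\<^esub> y \<in> N"
    and smult: "\<And>r x. \<lbrakk>r \<in> carrier R; x \<in> N\<rbrakk> \<Longrightarrow> r \<odot>\<^bsub>M\<^esub> x \<in> N"
  shows "submodule N R M"
proof (intro submodule.intro submodule_axioms.intro M.add.subgroupI)
  show "\<ominus>\<^bsub>M\<^esub> x \<in> N" if "x \<in> N" for x
  proof -
    have "(\<ominus> \<one>) \<odot>\<^bsub>M\<^esub> x = \<ominus>\<^bsub>M\<^esub> x"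
      using that assms(1) by (simp add: smult_minus_left subset_iff)
    then show ?thesis
      using smult[OF _ that, of "\<ominus> \<one>"] by simp
  qed
qed (use assms in auto)

lemma submoduleD:
  assumes "submodule N R M"
  shows "N \<subseteq> carrier M" "\<zero>\<^bsub>M\<^esub> \<in> N"
    and "\<And>x y. \<lbrakk>x \<in> N; y \<in> N\<rbrakk> \<Longrightarrow> x \<oplus>\<^bsub>M\<^esub> y \<in> N"
    and "\<And>r x. \<lbrakk>r \<in> carrier R; x \<in> N\<rbrakk> \<Longrightarrow> r \<odot>\<^bsub>M\<^esub> x \<in> N"
    and "\<And>x. x \<in> N \<Longrightarrow> \<ominus>\<^bsub>M\<^esub> x \<in> N"
    and "\<And>x y. \<lbrakk>x \<in> N; y \<in> N\<rbrakk> \<Longrightarrow> x \<ominus>\<^bsub>M\<^esub> y \<in> N"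
proof -
  interpret N: submodule N R M by fact
  show "N \<subseteq> carrier M" "\<zero>\<^bsub>M\<^esub> \<in> N"
    using N.subset N.one_closed by auto
  show *: "x \<oplus>\<^bsub>M\<^esub> y \<in> N" if "x \<in> N" "y \<in> N" for x y
    using N.m_closed that by simp
  show "r \<odot>\<^bsub>M\<^esub> x \<in> N" if "r \<in> carrier R" "x \<in> N" for r x
    using that by simp
  show **: "\<ominus>\<^bsub>M\<^esub> x \<in> N" if "x \<in> N" for x
    using N.m_inv_closed that by (simp add: a_inv_def)
  show "x \<ominus>\<^bsub>M\<^esub> y \<in> N" if "x \<in> N" "y \<in> N" for x y
    using * ** that by (simp add: a_minus_def)
qed

lemma left_module_submodule:
  assumes N: "submodule N R M"
  shows "left_module R (M\<lparr>carrier := N\<rparr>)"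
proof -
  note N' = submoduleD[OF N]
  have "abelian_group (M\<lparr>carrier := N\<rparr>)"
  proof (rule abelian_groupI)
    show "\<exists>y\<in>carrier (M\<lparr>carrier := N\<rparr>). y \<oplus>\<^bsub>M\<lparr>carrier := N\<rparr>\<^esub> x = \<zero>\<^bsub>M\<lparr>carrier := N\<rparr>\<^esub>"
      if "x \<in> carrier (M\<lparr>carrier := N\<rparr>)" for x
      using that N' by (intro bexI[of _ "\<ominus>\<^bsub>M\<^esub> x"]) (auto simp: M.l_neg subset_iff)
  qed (use N' in \<open>auto simp: subset_iff M.a_ac\<close>)
  then show ?thesis
    using N' by (intro left_module.intro left_module_axioms.intro R.ring_axioms)
      (auto simp: subset_iff smult_l_distr smult_r_distr smult_assoc)
qed

lemma submodule_of_submodule: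
  assumes V: "submodule V R M" and N: "submodule N R (M\<lparr>carrier := V\<rparr>)"
  shows "submodule N R M" "N \<subseteq> V"
proof -
  interpret V: left_module R "M\<lparr>carrier := V\<rparr>"
    by (rule left_module_submodule) fact
  show "N \<subseteq> V"
    using V.submoduleD(1)[OF N] by simp
  then show "submodule N R M"
    using V.submoduleD[OF N] submoduleD(1)[OF V] by (intro submoduleI) auto
qed

lemma submodule_cyclic:
  assumes "x \<in> carrier M"
  shows "submodule {r \<odot>\<^bsub>M\<^esub> x | r. r \<in> carrier R} R M"
proof (rule submoduleI)
  show "\<zero>\<^bsub>M\<^esub> \<in> {r \<odot>\<^bsub>M\<^esub> x | r. r \<in> carrier R}"
    using smult_zero_left[OF assms] by (metis (mono_tags, lifting) R.zero_closed mem_Collect_eq)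
  fix y z assume "y \<in> {r \<odot>\<^bsub>M\<^esub> x | r. r \<in> carrier R}" "z \<in> {r \<odot>\<^bsub>M\<^esub> x | r. r \<in> carrier R}"
  then obtain r s where "r \<in> carrier R" "s \<in> carrier R" "y = r \<odot>\<^bsub>M\<^esub> x" "z = s \<odot>\<^bsub>M\<^esub> x"
    by blast
  then show "y \<oplus>\<^bsub>M\<^esub> z \<in> {r \<odot>\<^bsub>M\<^esub> x | r. r \<in> carrier R}"
    using assms smult_l_distr[of r s x] by (metis (mono_tags, lifting) R.a_closed mem_Collect_eq)
next
  fix s y assume "s \<in> carrier R" "y \<in> {r \<odot>\<^bsub>M\<^esub> x | r. r \<in> carrier R}"
  then obtain r where "r \<in> carrier R" "s \<in> carrier R" "y = r \<odot>\<^bsub>M\<^esub> x"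
    by blast
  then show "s \<odot>\<^bsub>M\<^esub> y \<in> {r \<odot>\<^bsub>M\<^esub> x | r. r \<in> carrier R}"
    using assms smult_assoc[of s r x] by (metis (mono_tags, lifting) R.m_closed mem_Collect_eq)
qed (use assms in auto)

end

text \<open>Cosets in \<open>regular_module R\<close> are rewritten as cosets in \<open>R\<close>
  itself, the form in which \<open>V\<close> is given and in which products of ring elements can be
  computed.\<close>

locale left_ideal_quotient = ring R for R (structure) +
  fixes L
  assumes L: "submodule L R (regular_module R)"
begin

sublocale reg: left_module R "regular_module R"
  by (rule left_module_regular_module) (rule ring_axioms)

sublocale quo: left_module R "quotient_module (regular_module R) L"
  by (rule left_module_quotient_module[OF reg.left_module_axioms L])

lemma carrier_regular [simp]: "carrier (regular_module R) = carrier R"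
  and add_regular [simp]: "x \<oplus>\<^bsub>regular_module R\<^esub> y = x \<oplus> y"
  and zero_regular [simp]: "\<zero>\<^bsub>regular_module R\<^esub> = \<zero>"
  and smult_regular [simp]: "x \<odot>\<^bsub>regular_module R\<^esub> y = x \<otimes> y"
  by (simp_all add: regular_module_def)

lemma coset_regular [simp]: "L +>\<^bsub>regular_module R\<^esub> x = L +> x"
  by (simp add: a_r_coset_def')

sublocale L: abelian_subgroup L R
proof -
  have "subgroup L (add_monoid R)"
    using reg.submoduleD[OF L] reg.submoduleD(5)[OF L]
    by (intro add.subgroupI) (auto simp: regular_module_def a_inv_def m_inv_def)
  then show "abelian_subgroup L R"
    by (intro abelian_subgroupI3 additive_subgroupI is_abelian_group)
qed

lemma carrier_quotient: "carrier (quotient_module (regular_module R) L) = {L +> x | x. x \<in> carrier R}"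
  by (auto simp: quotient_module_def A_RCOSETS_def')

lemma zero_quotient: "\<zero>\<^bsub>quotient_module (regular_module R) L\<^esub> = L"
  by (simp add: quotient_module_def)

lemma add_quotient:
  assumes "x \<in> carrier R" "y \<in> carrier R"
  shows "(L +> x) \<oplus>\<^bsub>quotient_module (regular_module R) L\<^esub> (L +> y) = L +> (x \<oplus> y)"
proof -
  have "set_add (regular_module R) = set_add R"
    by (simp add: fun_eq_iff set_add_def regular_module_def set_mult_def)
  then show ?thesis
    using assms by (simp add: quotient_module_def L.a_rcos_sum)
qed

lemma smult_quotient:
  assumes r: "r \<in> carrier R" and x: "x \<in> carrier R"
  shows "r \<odot>\<^bsub>quotient_module (regular_module R) L\<^esub> (L +> x) = L +> (r \<otimes> x)"
proof -
  have eq: "L +> (r \<otimes> y) = L +> (r \<otimes> x)" if "y \<in> L +> x" for y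
  proof -
    from that obtain n where n: "n \<in> L" "y = n \<oplus> x"
      by (auto simp: a_r_coset_def')
    have "r \<otimes> y = r \<otimes> n \<oplus> r \<otimes> x"
      using n r x by (simp add: r_distr)
    moreover have "r \<otimes> n \<in> L"
      using reg.submoduleD(4)[OF L r n(1)] by simp
    ultimately have "r \<otimes> y \<in> L +> (r \<otimes> x)"
      unfolding a_r_coset_def' by blast
    then show ?thesis
      using a_repr_independence[OF _ _ L.a_subgroup] r x by (metis m_closed)
  qed
  have "r \<odot>\<^bsub>quotient_module (regular_module R) L\<^esub> (L +> x) = (\<Union>y\<in>L +> x. L +> (r \<otimes> y))"
    by (simp add: quotient_module_def)
  also have "\<dots> = (\<Union>y\<in>L +> x. L +> (r \<otimes> x))"
    by (rule SUP_cong[OF refl eq])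
  also have "\<dots> = L +> (r \<otimes> x)"
    using L.a_rcos_self[OF x] by blast
  finally show ?thesis .
qed

lemma coset_eq_iff:
  assumes "x \<in> carrier R" "y \<in> carrier R"
  shows "L +> x = L +> y \<longleftrightarrow> x \<ominus> y \<in> L"
proof -
  have "L +> x = L +> y \<longleftrightarrow> x \<in> L +> y"
    using assms L.a_rcos_self[of x] a_repr_independence[of x L y] L.a_subgroup by auto
  then show ?thesis
    using assms L.a_rcos_module[of y x] L.a_rcos_const by (simp add: a_minus_def)
qed

lemma coset_eq_zero_iff: "x \<in> carrier R \<Longrightarrow> L +> x = L \<longleftrightarrow> x \<in> L"
  using coset_eq_iff[of x \<zero>] L.a_subset by (simp add: a_minus_def)

lemma quotient_generator:
  assumes "X \<in> carrier (quotient_module (regular_module R) L)"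
  shows "\<exists>r\<in>carrier R. X = r \<odot>\<^bsub>quotient_module (regular_module R) L\<^esub> (L +> \<one>)"
  using assms by (auto simp: carrier_quotient smult_quotient)

end

lemma principal_left_ideal_quotient:
  "ring R \<Longrightarrow> z \<in> carrier R \<Longrightarrow> left_ideal_quotient R (principal_left_ideal R z)"
  by (simp add: left_ideal_quotient_def left_ideal_quotient_axioms_def
      principal_left_ideal_submodule)

text \<open>An element r z of the left ideal sends v to r (z v) = 0, so r v depends only on the
  coset of r. The coordinate maps of both W and M arise this way.\<close>

lemma principal_quotient_hom_exists:
  assumes "left_module R P" and z: "z \<in> carrier R" and v: "v \<in> carrier P"
    and zv: "z \<odot>\<^bsub>P\<^esub> v = \<zero>\<^bsub>P\<^esub>"
  defines "L \<equiv> principal_left_ideal R z"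
  obtains h where "h \<in> module_hom R (quotient_module (regular_module R) L) P"
    and "\<And>r. r \<in> carrier R \<Longrightarrow> h (L +>\<^bsub>R\<^esub> r) = r \<odot>\<^bsub>P\<^esub> v"
proof -
  interpret P: left_module R P by fact
  interpret Q: left_ideal_quotient R L
    unfolding L_def by (rule principal_left_ideal_quotient[OF P.R.ring_axioms z])
  let ?rep = "\<lambda>X. SOME r. r \<in> carrier R \<and> X = L +>\<^bsub>R\<^esub> r"
  define h where "h = (\<lambda>X. ?rep X \<odot>\<^bsub>P\<^esub> v)"
  have L: "l \<odot>\<^bsub>P\<^esub> v = \<zero>\<^bsub>P\<^esub>" if "l \<in> L" for l
  proof -
    from that obtain r where r: "r \<in> carrier R" "l = r \<otimes>\<^bsub>R\<^esub> z"
      unfolding L_def principal_left_ideal_def by blast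
    then have "l \<odot>\<^bsub>P\<^esub> v = r \<odot>\<^bsub>P\<^esub> (z \<odot>\<^bsub>P\<^esub> v)"
      using z v P.smult_assoc by simp
    then show ?thesis
      using r zv P.smult_zero_right by simp
  qed
  have h: "h (L +>\<^bsub>R\<^esub> r) = r \<odot>\<^bsub>P\<^esub> v" if r: "r \<in> carrier R" for r
  proof -
    let ?s = "?rep (L +>\<^bsub>R\<^esub> r)"
    have s: "?s \<in> carrier R \<and> L +>\<^bsub>R\<^esub> r = L +>\<^bsub>R\<^esub> ?s"
      by (rule someI[of _ r]) (use r in simp)
    then have "?s \<ominus>\<^bsub>R\<^esub> r \<in> L"
      using r Q.coset_eq_iff by metis
    then have "?s \<odot>\<^bsub>P\<^esub> v \<ominus>\<^bsub>P\<^esub> r \<odot>\<^bsub>P\<^esub> v = \<zero>\<^bsub>P\<^esub>"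
      using L s r v by (simp flip: P.smult_diff_left)
    then show ?thesis
      using s r v by (simp add: h_def P.M.minus_eq_zero_iff)
  qed
  have "h \<in> module_hom R (quotient_module (regular_module R) L) P"
    unfolding module_hom_def Q.carrier_quotient
    using v by (auto simp: Q.add_quotient Q.smult_quotient h P.smult_l_distr P.smult_assoc)
  with h that show thesis by blast
qed

section \<open>Linear representations of the quantum plane on function spaces\<close>

text \<open>The support is finite, and its words are split off one at a time. Identities that are
  additive in \<open>f\<close> thus reduce to monomials.\<close>

lemma free_algebra_induct [consumes 1, case_names monomial add]:
  fixes f :: "'x list \<Rightarrow> 'k::field"
  assumes "f \<in> carrier free_algebra"
    and monomial: "\<And>c w. P (monomial c w)"
    and add: "\<And>f g. \<lbrakk>f \<in> carrier free_algebra; g \<in> carrier free_algebra; P f; P g\<rbrakk>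
      \<Longrightarrow> P (f \<oplus>\<^bsub>free_algebra\<^esub> g)"
  shows "P f"
proof -
  have "P f" if "finite S" "{w. f w \<noteq> 0} \<subseteq> S" for S and f :: "'x list \<Rightarrow> 'k"
    using that
  proof (induction S arbitrary: f rule: finite_induct)
    case empty
    then have "f = monomial 0 []"
      by (auto simp: monomial_def)
    then show ?case
      using monomial by simp
  next
    case (insert w S)
    let ?g = "f(w := 0)"
    have "{v. ?g v \<noteq> 0} \<subseteq> S"
      using insert.prems by auto
    then have "P ?g" "?g \<in> carrier free_algebra"
      using insert.IH[of ?g] finite_subset[OF _ insert.hyps(1)]
      by (simp_all add: free_algebra_def del: fun_upd_apply)
    moreover have "f = monomial (f w) w \<oplus>\<^bsub>free_algebra\<^esub> ?g"
      by (auto simp: monomial_def free_algebra_def)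
    ultimately show ?case
      using add[OF monomial_closed _ monomial] by metis
  qed
  then show ?thesis
    using assms(1) by (auto simp: free_algebra_def)
qed

text \<open>
  A pair of operators on all functions suffices: the finitely supported functions appear only as
  the values of homomorphisms.
\<close>

locale qp_operators =
  fixes q :: "'k::field" and \<alpha> \<beta> :: "('x \<Rightarrow> 'k) \<Rightarrow> 'x \<Rightarrow> 'k"
  assumes \<alpha>_add: "\<alpha> (\<lambda>i. f i + g i) = (\<lambda>i. \<alpha> f i + \<alpha> g i)"
    and \<beta>_add: "\<beta> (\<lambda>i. f i + g i) = (\<lambda>i. \<beta> f i + \<beta> g i)"
    and \<alpha>_scale: "\<alpha> (\<lambda>i. c * f i) = (\<lambda>i. c * \<alpha> f i)"
    and \<beta>_scale: "\<beta> (\<lambda>i. c * f i) = (\<lambda>i. c * \<beta> f i)"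
    and \<alpha>_\<beta>: "\<alpha> (\<beta> f) = (\<lambda>i. q * \<beta> (\<alpha> f) i)"
begin

fun word_act :: "qp_gen list \<Rightarrow> ('x \<Rightarrow> 'k) \<Rightarrow> 'x \<Rightarrow> 'k" where
  "word_act [] p = p"
| "word_act (Gen_a # w) p = \<alpha> (word_act w p)"
| "word_act (Gen_b # w) p = \<beta> (word_act w p)"

lemma word_act_append: "word_act (v @ w) p = word_act v (word_act w p)"
  by (induction v p rule: word_act.induct) auto

lemma word_act_add: "word_act w (\<lambda>i. f i + g i) = (\<lambda>i. word_act w f i + word_act w g i)"
  by (induction w f rule: word_act.induct) (auto simp: \<alpha>_add \<beta>_add)

lemma word_act_scale: "word_act w (\<lambda>i. c * f i) = (\<lambda>i. c * word_act w f i)"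
  by (induction w f rule: word_act.induct) (auto simp: \<alpha>_scale \<beta>_scale)

definition free_act :: "(qp_gen list \<Rightarrow> 'k) \<Rightarrow> ('x \<Rightarrow> 'k) \<Rightarrow> 'x \<Rightarrow> 'k" where
  "free_act f p = (\<lambda>i. \<Sum>w | f w \<noteq> 0. f w * word_act w p i)"

lemma free_act_eq:
  assumes "finite S" "{w. f w \<noteq> 0} \<subseteq> S"
  shows "free_act f p i = (\<Sum>w\<in>S. f w * word_act w p i)"
  unfolding free_act_def using assms by (intro sum.mono_neutral_left) auto

lemma free_act_monomial: "free_act (monomial c w) p = (\<lambda>i. c * word_act w p i)"
  by (rule ext, subst free_act_eq[of "{w}"]) (auto simp: monomial_def)

lemma free_act_add:
  assumes "f \<in> carrier free_algebra" "g \<in> carrier free_algebra"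
  shows "free_act (f \<oplus>\<^bsub>free_algebra\<^esub> g) p = (\<lambda>i. free_act f p i + free_act g p i)"
proof
  fix i
  let ?S = "{w. f w \<noteq> 0} \<union> {w. g w \<noteq> 0}"
  have fin: "finite ?S"
    using assms by (auto simp: free_algebra_def)
  have fg: "f \<oplus>\<^bsub>free_algebra\<^esub> g = (\<lambda>w. f w + g w)"
    by (simp add: free_algebra_def)
  show "free_act (f \<oplus>\<^bsub>free_algebra\<^esub> g) p i = free_act f p i + free_act g p i"
    unfolding fg
    by (subst (1 2 3) free_act_eq[OF fin]) (auto simp: sum.distrib distrib_right)
qed

lemma free_act_right_add:
  "free_act f (\<lambda>i. p i + p' i) = (\<lambda>i. free_act f p i + free_act f p' i)"
  by (simp add: free_act_def word_act_add distrib_left sum.distrib)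

lemma free_act_right_scale: "free_act f (\<lambda>i. c * p i) = (\<lambda>i. c * free_act f p i)"
  by (simp add: free_act_def word_act_scale sum_distrib_left mult.left_commute)

lemma free_act_right_zero [simp]: "free_act f (\<lambda>i. 0) = (\<lambda>i. 0)"
  using free_act_right_scale[of f 0 "\<lambda>i. 0"] by simp

text \<open>Both sides are additive in \<open>f\<close> and in \<open>g\<close>. This leaves
  monomials, whose product is concatenation of words, and a concatenation acts as a
  composition.\<close>

lemma free_act_mult:
  assumes "f \<in> carrier free_algebra" "g \<in> carrier free_algebra"
  shows "free_act (f \<otimes>\<^bsub>free_algebra\<^esub> g) p = free_act f (free_act g p)"
proof -
  interpret F: ring "free_algebra :: (qp_gen list \<Rightarrow> 'k) ring" by (rule ring_free_algebra)
  have mono: "free_act (monomial c w \<otimes>\<^bsub>free_algebra\<^esub> g) p = free_act (monomial c w) (free_act g p)"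
    for c w
    using assms(2)
  proof (induction g rule: free_algebra_induct)
    case (monomial d v)
    then show ?case
      by (simp add: monomial_mult free_act_monomial word_act_append word_act_scale mult.assoc)
  next
    case (add f g)
    then show ?case
      by (simp add: F.r_distr monomial_closed free_act_add free_act_right_add)
  qed
  show ?thesis
    using assms(1)
  proof (induction f rule: free_algebra_induct)
    case (add f f')
    then show ?case
      using assms(2) by (simp add: F.l_distr free_act_add)
  qed (rule mono)
qed

text \<open>The elements that kill every function form a two-sided ideal, and the commutation rule
  of the two operators puts the defining relation into it.\<close>

lemma free_act_qp_ideal:
  assumes "f \<in> qp_ideal q"
  shows "free_act f p = (\<lambda>i. 0)"
proof -
  let ?F = "free_algebra :: (qp_gen list \<Rightarrow> 'k) ring"
  let ?K = "{f \<in> carrier ?F. \<forall>p. free_act f p = (\<lambda>i. 0)}"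
  interpret F: ring ?F by (rule ring_free_algebra)
  have minus: "free_act (\<ominus>\<^bsub>?F\<^esub> f) p = (\<lambda>i. - free_act f p i)" if "f \<in> carrier ?F" for f p
  proof -
    have "(\<lambda>i. free_act (\<ominus>\<^bsub>?F\<^esub> f) p i + free_act f p i) = free_act \<zero>\<^bsub>?F\<^esub> p"
      using that by (simp flip: free_act_add add: F.l_neg)
    also have "\<dots> = (\<lambda>i. 0)"
      by (simp add: free_act_def free_algebra_def)
    finally show ?thesis
      by (simp add: fun_eq_iff eq_neg_iff_add_eq_0)
  qed
  have "ideal ?K ?F"
  proof (rule idealI)
    show "subgroup ?K (add_monoid ?F)"
    proof (rule F.add.subgroupI)
      show "?K \<noteq> {}"
        by (auto intro!: exI[of _ "\<zero>\<^bsub>?F\<^esub>"]) (simp add: free_act_def free_algebra_def)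
    qed (auto simp: free_act_add minus)
  qed (auto simp: free_act_mult F.ring_axioms)
  moreover have "monomial 1 [Gen_a, Gen_b] \<ominus>\<^bsub>?F\<^esub> monomial q [Gen_b, Gen_a] \<in> ?K"
    by (simp add: a_minus_def monomial_closed free_act_add minus free_act_monomial \<alpha>_\<beta>)
  ultimately have "qp_ideal q \<subseteq> ?K"
    unfolding qp_ideal_def by (intro F.genideal_minimal) auto
  then show ?thesis
    using assms by auto
qed

text \<open>A coset acts through a chosen representative; the choice is harmless because the ideal
  acts by zero, as \<open>function_module_smult\<close> makes precise.\<close>

definition function_module :: "((qp_gen list \<Rightarrow> 'k) set, 'x \<Rightarrow> 'k) module" where
  "function_module = \<lparr>carrier = UNIV, mult = undefined, one = undefined, zero = (\<lambda>i. 0),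
    add = (\<lambda>f g i. f i + g i), smult = (\<lambda>X. free_act (SOME f. f \<in> X))\<rparr>"

lemma function_module_simps [simp]:
  "carrier function_module = UNIV"
  "\<zero>\<^bsub>function_module\<^esub> = (\<lambda>i. 0)"
  "f \<oplus>\<^bsub>function_module\<^esub> g = (\<lambda>i. f i + g i)"
  by (simp_all add: function_module_def)

lemma function_module_smult:
  assumes "f \<in> carrier free_algebra"
  shows "(qp_ideal q +>\<^bsub>free_algebra\<^esub> f) \<odot>\<^bsub>function_module\<^esub> p = free_act f p"
proof -
  interpret I: ideal "qp_ideal q" free_algebra by (rule ideal_qp_ideal)
  let ?X = "qp_ideal q +>\<^bsub>free_algebra\<^esub> f"
  have "(SOME g. g \<in> ?X) \<in> ?X"
    using I.a_rcos_self[OF assms] by (metis someI)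
  then obtain g where "g \<in> qp_ideal q" "(SOME g. g \<in> ?X) = g \<oplus>\<^bsub>free_algebra\<^esub> f"
    by (auto simp: a_r_coset_def')
  then show ?thesis
    using assms I.a_Hcarr[of g]
    by (simp add: function_module_def free_act_add free_act_qp_ideal)
qed

lemma left_module_function_module: "left_module (quantum_plane q) function_module"
proof -
  interpret I: ideal "qp_ideal q" free_algebra by (rule ideal_qp_ideal)
  have B: "carrier (quantum_plane q) = {qp_ideal q +>\<^bsub>free_algebra\<^esub> f | f. f \<in> carrier free_algebra}"
    by (auto simp: quantum_plane_def FactRing_def A_RCOSETS_def')
  have "abelian_group function_module"
    by (rule abelian_groupI)
      (auto simp: algebra_simps fun_eq_iff intro: exI[of _ "\<lambda>i. - f i" for f])
  then show ?thesis
  proof (intro left_module.intro left_module_axioms.intro ring_quantum_plane)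
    fix r s :: "(qp_gen list \<Rightarrow> 'k) set" and p p' :: "'x \<Rightarrow> 'k"
    assume r: "r \<in> carrier (quantum_plane q)"
    then obtain f where f: "f \<in> carrier free_algebra" "r = qp_ideal q +>\<^bsub>free_algebra\<^esub> f"
      using B by auto
    show "r \<odot>\<^bsub>function_module\<^esub> (p \<oplus>\<^bsub>function_module\<^esub> p')
        = r \<odot>\<^bsub>function_module\<^esub> p \<oplus>\<^bsub>function_module\<^esub> r \<odot>\<^bsub>function_module\<^esub> p'"
      using f by (simp add: function_module_smult free_act_right_add)
    assume "s \<in> carrier (quantum_plane q)"
    then obtain g where g: "g \<in> carrier free_algebra" "s = qp_ideal q +>\<^bsub>free_algebra\<^esub> g"
      using B by auto
    show "(r \<oplus>\<^bsub>quantum_plane q\<^esub> s) \<odot>\<^bsub>function_module\<^esub> p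
        = r \<odot>\<^bsub>function_module\<^esub> p \<oplus>\<^bsub>function_module\<^esub> s \<odot>\<^bsub>function_module\<^esub> p"
      using f g
      by (simp add: quantum_plane_def FactRing_def I.a_rcos_sum function_module_smult free_act_add)
    show "(r \<otimes>\<^bsub>quantum_plane q\<^esub> s) \<odot>\<^bsub>function_module\<^esub> p
        = r \<odot>\<^bsub>function_module\<^esub> (s \<odot>\<^bsub>function_module\<^esub> p)"
      using f g
      by (simp add: quantum_plane_def FactRing_def I.rcoset_mult_add function_module_smult
          free_act_mult)
  next
    fix p :: "'x \<Rightarrow> 'k"
    have "\<one>\<^bsub>quantum_plane q\<^esub> = qp_ideal q +>\<^bsub>free_algebra\<^esub> monomial 1 []"
      by (simp add: quantum_plane_def FactRing_def monomial_def free_algebra_def)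
    then show "\<one>\<^bsub>quantum_plane q\<^esub> \<odot>\<^bsub>function_module\<^esub> p = p"
      by (simp add: function_module_smult monomial_closed free_act_monomial)
  qed auto
qed

end

text \<open>The quantum plane is formalized as a bare ring, so the ground field enters through the
  classes of constants; these make every module a vector space via \<open>scal\<close>.\<close>

definition qp_const :: "'k::field \<Rightarrow> 'k \<Rightarrow> (qp_gen list \<Rightarrow> 'k) set" where
  "qp_const q c = qp_ideal q +>\<^bsub>free_algebra\<^esub> monomial c []"

lemma quantum_plane_coset_hom:
  "(+>\<^bsub>free_algebra\<^esub>) (qp_ideal q) \<in> ring_hom free_algebra (quantum_plane q)"
  unfolding quantum_plane_def by (rule ideal.rcos_ring_hom[OF ideal_qp_ideal])

lemma qp_closed [simp]:
  "qp_a q \<in> carrier (quantum_plane q)" "qp_b q \<in> carrier (quantum_plane q)"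
  "qp_const q c \<in> carrier (quantum_plane q)"
  unfolding qp_a_def qp_b_def qp_const_def
  by (rule ring_hom_closed[OF quantum_plane_coset_hom monomial_closed])+

lemma qp_const_mult: "qp_const q c \<otimes>\<^bsub>quantum_plane q\<^esub> qp_const q d = qp_const q (c * d)"
  and qp_const_a: "qp_const q c \<otimes>\<^bsub>quantum_plane q\<^esub> qp_a q = qp_a q \<otimes>\<^bsub>quantum_plane q\<^esub> qp_const q c"
  and qp_const_b: "qp_const q c \<otimes>\<^bsub>quantum_plane q\<^esub> qp_b q = qp_b q \<otimes>\<^bsub>quantum_plane q\<^esub> qp_const q c"
  by (simp_all flip: ring_hom_mult[OF quantum_plane_coset_hom]
      add: qp_const_def qp_a_def qp_b_def monomial_closed monomial_mult)

lemma qp_const_add: "qp_const q c \<oplus>\<^bsub>quantum_plane q\<^esub> qp_const q d = qp_const q (c + d)"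
proof -
  have "monomial c [] \<oplus>\<^bsub>free_algebra\<^esub> monomial d [] = monomial (c + d) ([] :: qp_gen list)"
    by (auto simp: monomial_def free_algebra_def)
  then show ?thesis
    by (simp flip: ring_hom_add[OF quantum_plane_coset_hom] add: qp_const_def monomial_closed)
qed

lemma qp_const_1:
  fixes q :: "'k::field"
  shows "qp_const q 1 = \<one>\<^bsub>quantum_plane q\<^esub>"
proof -
  have "(monomial 1 [] :: qp_gen list \<Rightarrow> 'k) = \<one>\<^bsub>free_algebra\<^esub>"
    by (simp add: monomial_def free_algebra_def)
  then show ?thesis
    by (simp add: qp_const_def ring_hom_one[OF quantum_plane_coset_hom])
qed

lemma quantum_plane_cases:
  assumes "r \<in> carrier (quantum_plane q)"
  obtains f where "f \<in> carrier free_algebra" "r = qp_ideal q +>\<^bsub>free_algebra\<^esub> f"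
  using assms by (auto simp: quantum_plane_def FactRing_def A_RCOSETS_def')

section \<open>Modules over the quantum plane\<close>

locale qp_module = left_module "quantum_plane q" M
  for q :: "'k::field" and M :: "((qp_gen list \<Rightarrow> 'k) set, 'm, 'd) module_scheme" (structure)
begin

definition act_a where "act_a x = qp_a q \<odot> x"
definition act_b where "act_b x = qp_b q \<odot> x"
definition scal where "scal c x = qp_const q c \<odot> x"

lemma act_closed [simp]:
  assumes "x \<in> carrier M"
  shows "act_a x \<in> carrier M" "act_b x \<in> carrier M" "scal c x \<in> carrier M"
  using assms by (simp_all add: act_a_def act_b_def scal_def)

lemma act_add:
  assumes "x \<in> carrier M" "y \<in> carrier M"
  shows "act_a (x \<oplus> y) = act_a x \<oplus> act_a y" "act_b (x \<oplus> y) = act_b x \<oplus> act_b y"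
    "scal c (x \<oplus> y) = scal c x \<oplus> scal c y"
  using assms by (simp_all add: act_a_def act_b_def scal_def smult_r_distr)

lemma act_zero [simp]: "act_a \<zero> = \<zero>" "act_b \<zero> = \<zero>" "scal c \<zero> = \<zero>"
  by (simp_all add: act_a_def act_b_def scal_def)

lemma scal_scal:
  assumes "x \<in> carrier M"
  shows "scal c (scal d x) = scal (c * d) x"
  using assms by (simp add: scal_def flip: smult_assoc qp_const_mult)

lemma scal_left_distrib:
  assumes "x \<in> carrier M"
  shows "scal (c + d) x = scal c x \<oplus> scal d x"
  using assms by (simp add: scal_def flip: smult_l_distr qp_const_add)

lemma scal_one [simp]: "x \<in> carrier M \<Longrightarrow> scal 1 x = x"
  by (simp add: scal_def qp_const_1)

lemma scal_zero [simp]: "x \<in> carrier M \<Longrightarrow> scal 0 x = \<zero>"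
  using scal_left_distrib[of x 0 0] by simp

lemma act_scal:
  assumes "x \<in> carrier M"
  shows "act_a (scal c x) = scal c (act_a x)" "act_b (scal c x) = scal c (act_b x)"
  using assms
  by (simp_all add: act_a_def act_b_def scal_def flip: smult_assoc qp_const_a qp_const_b)

lemma act_a_act_b: "x \<in> carrier M \<Longrightarrow> act_a (act_b x) = scal q (act_b (act_a x))"
  by (simp add: act_a_def act_b_def scal_def qp_const_def quantum_plane_relation
      flip: smult_assoc qp_const_def)

text \<open>Every ring element is the class of a combination of words, and words act by iterating a
  and b. Stability under the ring thus reduces to the generators and the scalars.\<close>

lemma smult_mem:
  assumes N: "N \<subseteq> carrier M"
    and add: "\<And>x y. \<lbrakk>x \<in> N; y \<in> N\<rbrakk> \<Longrightarrow> x \<oplus> y \<in> N"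
    and scal: "\<And>c x. x \<in> N \<Longrightarrow> scal c x \<in> N"
    and act: "\<And>x. x \<in> N \<Longrightarrow> act_a x \<in> N" "\<And>x. x \<in> N \<Longrightarrow> act_b x \<in> N"
    and r: "r \<in> carrier (quantum_plane q)" and x: "x \<in> N"
  shows "r \<odot> x \<in> N"
proof -
  let ?cl = "(+>\<^bsub>free_algebra\<^esub>) (qp_ideal q)"
  note hom = quantum_plane_coset_hom[of q]
  obtain f where f: "f \<in> carrier free_algebra" and r: "r = ?cl f"
    using r by (rule quantum_plane_cases)
  have word: "?cl (monomial 1 w) \<odot> x \<in> N" for w
  proof (induction w)
    case Nil
    then show ?case
      using scal[OF x, of 1] by (simp add: scal_def qp_const_def)
  next
    case (Cons g w)
    have eq: "?cl (monomial 1 (g # w)) = ?cl (monomial 1 [g]) \<otimes>\<^bsub>quantum_plane q\<^esub> ?cl (monomial 1 w)"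
      using ring_hom_mult[OF hom monomial_closed monomial_closed, of 1 "[g]" 1 w]
      by (simp add: monomial_mult)
    have "?cl (monomial 1 (g # w)) \<odot> x = ?cl (monomial 1 [g]) \<odot> (?cl (monomial 1 w) \<odot> x)"
      unfolding eq using x N
      by (intro smult_assoc ring_hom_closed[OF hom] monomial_closed) auto
    then show ?case
      using act[OF Cons.IH] by (cases g) (simp_all add: act_a_def act_b_def qp_a_def qp_b_def)
  qed
  show ?thesis
    unfolding r using f
  proof (induction f rule: free_algebra_induct)
    case (monomial c w)
    have eq: "?cl (monomial c w) = ?cl (monomial c []) \<otimes>\<^bsub>quantum_plane q\<^esub> ?cl (monomial 1 w)"
      using ring_hom_mult[OF hom monomial_closed monomial_closed, of c "[]" 1 w]
      by (simp add: monomial_mult)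
    have "?cl (monomial c w) \<odot> x = ?cl (monomial c []) \<odot> (?cl (monomial 1 w) \<odot> x)"
      unfolding eq using x N
      by (intro smult_assoc ring_hom_closed[OF hom] monomial_closed) auto
    then show ?case
      using scal[OF word] by (simp add: scal_def qp_const_def)
  next
    case (add f g)
    then have "?cl (f \<oplus>\<^bsub>free_algebra\<^esub> g) \<odot> x = ?cl f \<odot> x \<oplus> ?cl g \<odot> x"
      using x N by (simp add: ring_hom_add[OF hom] smult_l_distr ring_hom_closed[OF hom] subset_iff)
    then show ?case
      using add assms(2) by simp
  qed
qed

lemma qp_submoduleI:
  assumes "N \<subseteq> carrier M" "\<zero> \<in> N"
    and "\<And>x y. \<lbrakk>x \<in> N; y \<in> N\<rbrakk> \<Longrightarrow> x \<oplus> y \<in> N"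
    and "\<And>c x. x \<in> N \<Longrightarrow> scal c x \<in> N"
    and "\<And>x. x \<in> N \<Longrightarrow> act_a x \<in> N" "\<And>x. x \<in> N \<Longrightarrow> act_b x \<in> N"
  shows "submodule N (quantum_plane q) M"
  using assms by (intro submoduleI smult_mem) auto

lemma qp_submoduleD:
  assumes "submodule N (quantum_plane q) M" "x \<in> N"
  shows "scal c x \<in> N" "act_a x \<in> N" "act_b x \<in> N"
  using submoduleD(4)[OF assms(1) _ assms(2)] by (simp_all add: act_a_def act_b_def scal_def)

text \<open>A sum over an infinite support is \<open>\<zero>\<close> by convention, hence the
  finiteness condition in \<open>lin_span\<close>.\<close>

definition lincomb :: "('x \<Rightarrow> 'm) \<Rightarrow> ('x \<Rightarrow> 'k) \<Rightarrow> 'm" where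
  "lincomb u c = (\<Oplus>i\<in>{i. c i \<noteq> 0}. scal (c i) (u i))"

definition lin_span :: "('x \<Rightarrow> 'm) \<Rightarrow> 'm set" where
  "lin_span u = {lincomb u c | c. finite {i. c i \<noteq> 0}}"

context
  fixes u :: "'x \<Rightarrow> 'm"
  assumes u [simp]: "u i \<in> carrier M"
begin

lemma lincomb_closed [simp]: "lincomb u c \<in> carrier M"
  unfolding lincomb_def by (rule M.finsum_closed) auto

lemma lincomb_eq:
  assumes "finite S" "{i. c i \<noteq> 0} \<subseteq> S"
  shows "lincomb u c = (\<Oplus>i\<in>S. scal (c i) (u i))"
  unfolding lincomb_def
  using assms by (intro M.add.finprod_mono_neutral_cong_left) auto

lemma lincomb_mem:
  assumes N: "submodule N (quantum_plane q) M"
    and fin: "finite {i. c i \<noteq> 0}" and mem: "\<And>i. c i \<noteq> 0 \<Longrightarrow> u i \<in> N"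
  shows "lincomb u c \<in> N"
proof -
  have "(\<Oplus>i\<in>S. scal (c i) (u i)) \<in> N" if "finite S" "S \<subseteq> {i. c i \<noteq> 0}" for S
    using that by (induction S rule: finite_induct) (auto simp: submoduleD[OF N] qp_submoduleD[OF N] mem)
  then show ?thesis
    unfolding lincomb_def using fin by blast
qed

lemma lin_span_add:
  assumes "x \<in> lin_span u" "y \<in> lin_span u"
  shows "x \<oplus> y \<in> lin_span u"
proof -
  obtain c d where c: "x = lincomb u c" "finite {i. c i \<noteq> 0}"
    and d: "y = lincomb u d" "finite {i. d i \<noteq> 0}"
    using assms by (auto simp: lin_span_def)
  let ?S = "{i. c i \<noteq> 0} \<union> {i. d i \<noteq> 0}"
  have fin: "finite ?S" using c d by simp
  have sub: "{i. c i + d i \<noteq> 0} \<subseteq> ?S" by auto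
  have "x \<oplus> y = lincomb u (\<lambda>i. c i + d i)"
    unfolding c d using sub
    by (simp add: lincomb_eq[OF fin] scal_left_distrib M.finsum_addf)
  then show ?thesis
    unfolding lin_span_def using finite_subset[OF sub fin] by blast
qed

lemma lin_span_scal_u [simp]: "scal k (u i) \<in> lin_span u"
proof -
  let ?c = "\<lambda>j. if j = i then k else 0"
  have fin: "finite {j. ?c j \<noteq> 0}"
    by (rule finite_subset[of _ "{i}"]) auto
  have "lincomb u ?c = (\<Oplus>j\<in>{i}. scal (?c j) (u j))"
    by (rule lincomb_eq) auto
  then have "lincomb u ?c = scal k (u i)"
    by simp
  then show ?thesis
    unfolding lin_span_def using fin by (intro CollectI exI[of _ ?c]) simp
qed

lemma lin_span_u [simp]: "u i \<in> lin_span u"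
  using lin_span_scal_u[of 1 i] by simp

lemma lin_span_subset: "lin_span u \<subseteq> carrier M"
  by (auto simp: lin_span_def)

lemma lin_span_zero [simp]: "\<zero> \<in> lin_span u"
  using lin_span_scal_u[of 0] by simp

lemma lin_span_linear_image:
  assumes x: "x \<in> lin_span u"
    and T: "T \<zero> = \<zero>" "\<And>x y. \<lbrakk>x \<in> carrier M; y \<in> carrier M\<rbrakk> \<Longrightarrow> T (x \<oplus> y) = T x \<oplus> T y"
    and Tu: "\<And>c i. T (scal c (u i)) \<in> lin_span u"
  shows "T x \<in> lin_span u"
proof -
  have "T (\<Oplus>i\<in>S. scal (c i) (u i)) \<in> lin_span u" if "finite S" for S c
    using that by (induction S rule: finite_induct) (simp_all add: T Tu lin_span_add)
  then show ?thesis
    using x by (auto simp: lin_span_def lincomb_def)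
qed

lemma lin_span_scal: "x \<in> lin_span u \<Longrightarrow> scal k x \<in> lin_span u"
  by (erule lin_span_linear_image) (simp_all add: act_add scal_scal)

text \<open>A subspace stable under a and b is a submodule, and it contains a generator of the
  module.\<close>

lemma lin_span_eq_carrier:
  assumes g: "g \<in> lin_span u" "\<And>x. x \<in> carrier M \<Longrightarrow> \<exists>r\<in>carrier (quantum_plane q). x = r \<odot> g"
    and "\<And>i. act_a (u i) \<in> lin_span u" "\<And>i. act_b (u i) \<in> lin_span u"
  shows "lin_span u = carrier M"
proof -
  have "act_a x \<in> lin_span u" "act_b x \<in> lin_span u" if "x \<in> lin_span u" for x
    using that
    by (rule lin_span_linear_image; simp add: act_add act_scal lin_span_scal assms)+
  then have "r \<odot> g \<in> lin_span u" if "r \<in> carrier (quantum_plane q)" for r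
    using that g(1) by (intro smult_mem lin_span_subset lin_span_add lin_span_scal)
  then show ?thesis
    using g(2) lin_span_subset by blast
qed

end

end

text \<open>A module with coordinates: since \<open>h\<close> maps the spanning family
  \<open>u\<close> to delta functions, \<open>u\<close> is a basis and \<open>h\<close> the
  coordinate map, under which a and b become explicit operators.\<close>

locale qp_model = qp_module q M
  for q :: "'k::field" and M :: "((qp_gen list \<Rightarrow> 'k) set, 'm, 'd) module_scheme" (structure) +
  fixes \<alpha> \<beta> :: "('x \<Rightarrow> 'k) \<Rightarrow> 'x \<Rightarrow> 'k" and h :: "'m \<Rightarrow> 'x \<Rightarrow> 'k" and u :: "'x \<Rightarrow> 'm"
  assumes h_add: "\<lbrakk>x \<in> carrier M; y \<in> carrier M\<rbrakk> \<Longrightarrow> h (x \<oplus> y) = (\<lambda>i. h x i + h y i)"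
    and h_scal: "x \<in> carrier M \<Longrightarrow> h (scal c x) = (\<lambda>i. c * h x i)"
    and h_a: "x \<in> carrier M \<Longrightarrow> h (act_a x) = \<alpha> (h x)"
    and h_b: "x \<in> carrier M \<Longrightarrow> h (act_b x) = \<beta> (h x)"
    and u_closed [simp]: "u i \<in> carrier M"
    and h_u: "h (u i) = (\<lambda>j. if j = i then 1 else 0)"
    and span_u: "lin_span u = carrier M"
begin

lemma h_zero [simp]: "h \<zero> = (\<lambda>i. 0)"
  using h_scal[of \<zero> 0] by simp

lemma h_minus:
  assumes "x \<in> carrier M" "y \<in> carrier M"
  shows "h (x \<ominus> y) = (\<lambda>i. h x i - h y i)"
proof -
  have "(\<lambda>i. h (x \<ominus> y) i + h y i) = h x"
    using assms by (simp add: M.minus_eq M.a_assoc M.l_neg flip: h_add)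
  then show ?thesis
    by (metis add_diff_cancel_right')
qed

lemma h_lincomb:
  assumes "finite {i. c i \<noteq> 0}"
  shows "h (lincomb u c) = c"
proof -
  have "h (\<Oplus>i\<in>S. scal (c i) (u i)) = (\<lambda>i. if i \<in> S then c i else 0)" if "finite S" for S
    using that
    by (induction S rule: finite_induct) (auto simp: h_add h_scal h_u)
  from this[OF assms] show ?thesis
    by (auto simp: lincomb_def)
qed

text \<open>Each element is \<open>lincomb u c\<close> for some finitely supported \<open>c\<close>,
  because \<open>u\<close> spans, and \<open>h\<close> recovers this \<open>c\<close>.\<close>

lemma finite_support: "x \<in> carrier M \<Longrightarrow> finite {i. h x i \<noteq> 0}"
  and lincomb_h: "x \<in> carrier M \<Longrightarrow> lincomb u (h x) = x"
  using h_lincomb by (auto simp: lin_span_def simp flip: span_u)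

lemma h_inject: "\<lbrakk>x \<in> carrier M; y \<in> carrier M\<rbrakk> \<Longrightarrow> h x = h y \<longleftrightarrow> x = y"
  by (metis lincomb_h)

lemma h_eq_zero_iff: "x \<in> carrier M \<Longrightarrow> h x = (\<lambda>i. 0) \<longleftrightarrow> x = \<zero>"
  using h_inject[of x \<zero>] by simp

lemma mem_submoduleI:
  assumes "submodule N (quantum_plane q) M" "x \<in> carrier M" "\<And>i. h x i \<noteq> 0 \<Longrightarrow> u i \<in> N"
  shows "x \<in> N"
  using lincomb_mem[of u N "h x"] assms finite_support lincomb_h by simp

text \<open>
  Applying the factors \<open>D - \<mu>\<^sub>j\<close> for the \<open>j \<noteq> i\<close> in the support kills every component
  in \<open>Y\<close> except the one at \<open>i\<close>.
\<close>

lemma isolate_eigencomponent: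
  assumes N: "submodule N (quantum_plane q) M"
    and D: "\<And>x. x \<in> N \<Longrightarrow> D x \<in> N" "\<And>x j. \<lbrakk>x \<in> N; j \<in> Y\<rbrakk> \<Longrightarrow> h (D x) j = \<mu> j * h x j"
    and inj: "inj_on \<mu> Y" and x: "x \<in> N" and i: "i \<in> Y" "h x i \<noteq> 0"
  obtains y where "y \<in> N" "\<And>j. j \<in> Y \<Longrightarrow> h y j = (if j = i then 1 else 0)"
proof -
  note N' = submoduleD[OF N] qp_submoduleD[OF N]
  \<comment> \<open>\<open>S\<close> holds the indices already dealt with. Zeros of \<open>x\<close>
    in \<open>Y\<close> are never destroyed, so the support of \<open>x\<close> without
    \<open>i\<close> is enough in the end; coordinates outside \<open>Y\<close> are
    uncontrolled.\<close>
  have "\<exists>y\<in>N. h y i \<noteq> 0 \<and> (\<forall>j\<in>Y. j \<in> S \<or> h x j = 0 \<longrightarrow> h y j = 0)"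
    if "finite S" "i \<notin> S" for S
    using that
  proof (induction S rule: finite_induct)
    case empty
    then show ?case
      using x i by auto
  next
    case (insert s S)
    then obtain y where y: "y \<in> N" "h y i \<noteq> 0" "\<And>j. j \<in> Y \<Longrightarrow> j \<in> S \<or> h x j = 0 \<Longrightarrow> h y j = 0"
      by blast
    show ?case
    proof (cases "s \<in> Y")
      case True
      let ?z = "D y \<ominus> scal (\<mu> s) y"
      have z: "h ?z j = (\<mu> j - \<mu> s) * h y j" if "j \<in> Y" for j
        using y(1) N'(1) D that by (simp add: subset_iff h_minus h_scal algebra_simps)
      moreover have "\<mu> i \<noteq> \<mu> s"
        using True insert.prems i(1) inj by (auto dest: inj_onD)
      moreover have "?z \<in> N"
        using y(1) N' D by simp
      ultimately show ?thesis
        using y(2,3) i(1) by (intro bexI[of _ ?z]) auto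
    next
      case False
      then show ?thesis
        using y by (intro bexI[of _ y]) auto
    qed
  qed
  from this[of "{j. h x j \<noteq> 0} - {i}"] obtain y where
    y: "y \<in> N" "h y i \<noteq> 0" "\<And>j. j \<in> Y \<Longrightarrow> j \<noteq> i \<Longrightarrow> h y j = 0"
    using finite_support x N'(1) by blast
  show thesis
  proof
    show "scal (inverse (h y i)) y \<in> N"
      using y N' by simp
    show "h (scal (inverse (h y i)) y) j = (if j = i then 1 else 0)" if "j \<in> Y" for j
      using y N'(1) that by (simp add: h_scal subset_iff)
  qed
qed

end

context qp_operators
begin

interpretation F: qp_module q function_module
  by (intro qp_module.intro left_module_function_module)

lemma function_module_act:
  "qp_a q \<odot>\<^bsub>function_module\<^esub> p = \<alpha> p" "qp_b q \<odot>\<^bsub>function_module\<^esub> p = \<beta> p"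
  "qp_const q c \<odot>\<^bsub>function_module\<^esub> p = (\<lambda>i. c * p i)"
  by (simp_all add: qp_a_def qp_b_def qp_const_def function_module_smult monomial_closed
      free_act_monomial)

lemma function_module_minus: "f \<ominus>\<^bsub>function_module\<^esub> g = (\<lambda>i. f i - g i)"
proof -
  have "(\<ominus>\<^bsub>function_module\<^esub> g) i = - g i" for i
    using F.M.l_neg[of g] by (simp add: fun_eq_iff eq_neg_iff_add_eq_0)
  then show ?thesis
    by (simp add: a_minus_def)
qed

lemma qp_modelI:
  assumes "qp_module q M" and h: "h \<in> module_hom (quantum_plane q) M function_module"
    and "\<And>i. u i \<in> carrier M" "\<And>i. h (u i) = (\<lambda>j. if j = i then 1 else 0)"
    and "qp_module.lin_span q M u = carrier M"
  shows "qp_model q M \<alpha> \<beta> h u"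
proof -
  interpret qp_module q M by fact
  show ?thesis
    using assms
    by unfold_locales
      (auto simp: module_hom_def act_a_def act_b_def scal_def function_module_act)
qed

end

section \<open>Distinctness of the eigenvalues\<close>

lemma inj_power_int_non_root:
  fixes q :: "'k::field"
  assumes q: "q \<noteq> 0" "\<forall>n>0. q ^ n \<noteq> 1"
  shows "inj (\<lambda>i::int. q powi i)"
proof (rule linorder_injI)
  fix i j :: int assume "i < j"
  then have "q powi j = q powi i * q ^ nat (j - i)"
    using q(1) by (simp flip: power_int_of_nat power_int_add)
  then show "q powi i \<noteq> q powi j"
    using q \<open>i < j\<close> by auto
qed

lemma inj_power_non_root:
  fixes q :: "'k::field"
  assumes q: "q \<noteq> 0" "\<forall>n>0. q ^ n \<noteq> 1"
  shows "inj (\<lambda>n::nat. q ^ n)"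
proof (rule injI)
  fix m n :: nat assume "q ^ m = q ^ n"
  then show "m = n"
    using injD[OF inj_power_int_non_root[OF q], of "int m" "int n"] by simp
qed

section \<open>The module \<open>W\<close>\<close>

definition W_alpha :: "'k::field \<Rightarrow> (nat \<Rightarrow> 'k) \<Rightarrow> nat \<Rightarrow> 'k" where
  "W_alpha q p = (\<lambda>n. q ^ n * p n)"

definition W_beta :: "(nat \<Rightarrow> 'k::field) \<Rightarrow> nat \<Rightarrow> 'k" where
  "W_beta p = (\<lambda>n. case n of 0 \<Rightarrow> 0 | Suc m \<Rightarrow> p m)"

lemma qp_operators_W: "qp_operators q (W_alpha q) W_beta"
  by unfold_locales (auto simp: W_alpha_def W_beta_def algebra_simps fun_eq_iff split: nat.splits)

lemma (in qp_module) lin_span_W: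
  assumes w: "w \<in> carrier M" "act_a w = w"
    and gen: "\<And>x. x \<in> carrier M \<Longrightarrow> \<exists>r\<in>carrier (quantum_plane q). x = r \<odot> w"
  shows "lin_span (\<lambda>n. (act_b ^^ n) w) = carrier M"
proof -
  let ?u = "\<lambda>n. (act_b ^^ n) w"
  have u: "?u n \<in> carrier M" for n
    using w by (induction n) auto
  have a: "act_a (?u n) = scal (q ^ n) (?u n)" for n
    by (induction n) (use w in \<open>simp_all add: u act_a_act_b act_scal scal_scal\<close>)
  show ?thesis
  proof (rule lin_span_eq_carrier[OF u _ gen])
    show "w \<in> lin_span ?u"
      using lin_span_u[of ?u 0, OF u] by simp
    show "act_a (?u n) \<in> lin_span ?u" for n
      unfolding a by (rule lin_span_scal_u[OF u])
    show "act_b (?u n) \<in> lin_span ?u" for n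
      using lin_span_u[of ?u "Suc n", OF u] by simp
  qed
qed

lemma W_model_exists:
  assumes "qp_module q M" and h: "h \<in> module_hom (quantum_plane q) M (qp_operators.function_module (W_alpha q) W_beta)"
    and w: "w \<in> carrier M" "qp_a q \<odot>\<^bsub>M\<^esub> w = w" and hw: "h w = (\<lambda>n. if n = 0 then 1 else 0)"
    and gen: "\<And>x. x \<in> carrier M \<Longrightarrow> \<exists>r\<in>carrier (quantum_plane q). x = r \<odot>\<^bsub>M\<^esub> w"
  shows "qp_model q M (W_alpha q) W_beta h (\<lambda>n. (qp_module.act_b q M ^^ n) w)"
proof -
  interpret qp_module q M by fact
  interpret op: qp_operators q "W_alpha q" W_beta by (rule qp_operators_W)
  have u: "(act_b ^^ n) w \<in> carrier M" for n
    using w by (induction n) auto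
  have hb: "h (act_b x) = W_beta (h x)" if "x \<in> carrier M" for x
    using h that by (simp add: module_hom_def act_b_def op.function_module_act)
  show ?thesis
  proof (rule op.qp_modelI[OF qp_module_axioms h u])
    show "h ((act_b ^^ n) w) = (\<lambda>j. if j = n then 1 else 0)" for n
      by (induction n) (auto simp: hw hb u W_beta_def fun_eq_iff split: nat.splits)
  qed (use w gen in \<open>intro lin_span_W; simp add: act_a_def\<close>)
qed

locale W_model = qp_model q M "W_alpha q" W_beta h u
  for q :: "'k::field" and M :: "((qp_gen list \<Rightarrow> 'k) set, 'm, 'd) module_scheme" (structure) and h u +
  assumes q_nonzero: "q \<noteq> 0" and q_non_root: "\<forall>n>0. q ^ n \<noteq> 1"
begin

text \<open>The basis is known only through its coordinates, so the action on it is read off there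
  and transported back by injectivity of \<open>h\<close>.\<close>

lemma act_a_u: "act_a (u n) = scal (q ^ n) (u n)"
  by (subst h_inject[symmetric]) (auto simp: h_a h_scal h_u W_alpha_def)

lemma act_b_u: "act_b (u n) = u (Suc n)"
  by (subst h_inject[symmetric]) (auto simp: h_b h_u W_beta_def split: nat.splits)

lemma u_mem:
  assumes N: "submodule N (quantum_plane q) M" and x: "x \<in> N" "h x n \<noteq> 0"
  shows "u n \<in> N"
proof -
  note N' = submoduleD[OF N] qp_submoduleD[OF N]
  obtain y where y: "y \<in> N" "\<And>j. h y j = (if j = n then 1 else 0)"
    by (rule isolate_eigencomponent[OF N, of act_a UNIV "\<lambda>n. q ^ n" x n])
      (use N' x inj_power_non_root[OF q_nonzero q_non_root] in
        \<open>auto simp: h_a W_alpha_def subset_iff\<close>)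
  then have "h y = h (u n)"
    by (auto simp: h_u)
  then show ?thesis
    using y(1) N'(1) h_inject[of y "u n"] by auto
qed

lemma u_mem_mono:
  assumes N: "submodule N (quantum_plane q) M" and "u n \<in> N" "n \<le> m"
  shows "u m \<in> N"
  using assms(3,2)
proof (induction m rule: dec_induct)
  case (step m)
  then show ?case
    using qp_submoduleD(3)[OF N, of "u m"] by (simp add: act_b_u)
qed

lemma submodules_linear:
  assumes N: "submodule N (quantum_plane q) M" and N': "submodule N' (quantum_plane q) M"
  shows "N \<subseteq> N' \<or> N' \<subseteq> N"
proof (rule disjCI)
  assume "\<not> N' \<subseteq> N"
  then obtain y where y: "y \<in> N'" "y \<notin> N" by auto
  then obtain n where n: "h y n \<noteq> 0" "u n \<notin> N"
    using mem_submoduleI[OF N] submoduleD(1)[OF N'] by blast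
  \<comment> \<open>This index separates the submodules: all basis vectors in \<open>N\<close> have
    index at least \<open>n\<close>, and all of those lie in \<open>N'\<close>.\<close>
  have "u n \<in> N'"
    using u_mem[OF N' y(1) n(1)] .
  show "N \<subseteq> N'"
  proof
    fix x assume x: "x \<in> N"
    have "u m \<in> N'" if "h x m \<noteq> 0" for m
    proof -
      have "u m \<in> N"
        using u_mem[OF N x that] .
      then have "n \<le> m"
        using n(2) u_mem_mono[OF N] by (metis nat_le_linear)
      then show ?thesis
        using u_mem_mono[OF N' \<open>u n \<in> N'\<close>] by simp
    qed
    then show "x \<in> N'"
      using mem_submoduleI[OF N'] x submoduleD(1)[OF N] by blast
  qed
qed

text \<open>
  A homomorphism maps the eigenvector \<open>u n\<close> of \<open>a\<close> to an eigenvector for the same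
  eigenvalue, hence to a multiple of \<open>u n\<close>.
\<close>

lemma hom_image_subset:
  assumes N: "submodule N (quantum_plane q) M" and N': "submodule N' (quantum_plane q) M"
    and f: "f \<in> module_hom (quantum_plane q) (M\<lparr>carrier := N\<rparr>) (M\<lparr>carrier := N'\<rparr>)"
  shows "f ` N \<subseteq> N"
proof -
  note D = submoduleD[OF N] qp_submoduleD[OF N]
  note D' = submoduleD[OF N'] qp_submoduleD[OF N']
  have f_mem: "f x \<in> N'" if "x \<in> N" for x
    using f that by (auto simp: module_hom_def)
  have f_add: "f (x \<oplus> y) = f x \<oplus> f y" if "x \<in> N" "y \<in> N" for x y
    using f that by (auto simp: module_hom_def)
  have f_smult: "f (r \<odot> x) = r \<odot> f x" if "r \<in> carrier (quantum_plane q)" "x \<in> N" for r x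
    using f that by (auto simp: module_hom_def)
  have f_carrier [simp]: "f x \<in> carrier M" if "x \<in> N" for x
    using f_mem[OF that] D'(1) by auto
  have f_zero: "f \<zero> = \<zero>"
    using f_smult[of "\<zero>\<^bsub>quantum_plane q\<^esub>" \<zero>] D(2) by simp
  \<comment> \<open>\<open>?K\<close> is a submodule, so it equals \<open>N\<close> as soon as it
    contains the basis vectors occurring in elements of \<open>N\<close>.\<close>
  let ?K = "{x \<in> N. f x \<in> N}"
  have K: "submodule ?K (quantum_plane q) M"
    using D by (intro submoduleI) (auto simp: f_add f_smult f_zero)
  have "u n \<in> ?K" if u: "u n \<in> N" for n
  proof -
    have "act_a (f (u n)) = f (act_a (u n))"
      using u f_smult by (simp add: act_a_def)
    also have "\<dots> = scal (q ^ n) (f (u n))"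
      unfolding act_a_u using u f_smult by (simp add: scal_def)
    finally have "h (act_a (f (u n))) = h (scal (q ^ n) (f (u n)))"
      by simp
    \<comment> \<open>The powers of q are distinct, so only the coordinate at \<open>n\<close>
      survives, and \<open>u n\<close> lies in \<open>N\<close>.\<close>
    then have "q ^ j * h (f (u n)) j = q ^ n * h (f (u n)) j" for j
      using u by (simp add: h_a h_scal W_alpha_def fun_eq_iff)
    then have "h (f (u n)) j = 0" if "j \<noteq> n" for j
      using that inj_power_non_root[OF q_nonzero q_non_root] by (auto dest: injD)
    then have "f (u n) \<in> N"
      using u f_carrier[OF u] by (metis mem_submoduleI[OF N])
    then show ?thesis
      using u by simp
  qed
  then have "x \<in> ?K" if "x \<in> N" for x
    using that u_mem[OF N that] D(1) mem_submoduleI[OF K] by blast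
  then show ?thesis
    by auto
qed

text \<open>\<open>hom_image_subset\<close> applies to an isomorphism and to its inverse, giving one
  inclusion each.\<close>

lemma isomorphic_submodules_eq:
  assumes N: "submodule N (quantum_plane q) M" and N': "submodule N' (quantum_plane q) M"
    and iso: "isomorphic_modules (quantum_plane q) (M\<lparr>carrier := N\<rparr>) (M\<lparr>carrier := N'\<rparr>)"
  shows "N = N'"
proof -
  note D = submoduleD[OF N]
  obtain f where f: "f \<in> module_hom (quantum_plane q) (M\<lparr>carrier := N\<rparr>) (M\<lparr>carrier := N'\<rparr>)"
    and bij: "bij_betw f N N'"
    using iso by (auto simp: isomorphic_modules_def)
  let ?g = "inv_into N f"
  have g: "?g x \<in> N" "f (?g x) = x" if "x \<in> N'" for x
    using bij that by (auto simp: bij_betw_def inv_into_into f_inv_into_f)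
  have gI: "?g x = y" if "y \<in> N" "f y = x" for x y
    using bij that by (auto simp: bij_betw_def)
  have "?g \<in> module_hom (quantum_plane q) (M\<lparr>carrier := N'\<rparr>) (M\<lparr>carrier := N\<rparr>)"
    using f D g by (auto simp: module_hom_def intro!: gI)
  then have "?g ` N' \<subseteq> N'"
    using hom_image_subset N N' by blast
  moreover have "f ` N \<subseteq> N"
    using hom_image_subset N N' f by blast
  moreover have "f ` N = N'" "?g ` N' = N"
    using bij bij_betw_inv_into[OF bij] by (auto simp: bij_betw_def)
  ultimately show ?thesis
    by blast
qed

end

section \<open>The module \<open>M\<close>\<close>

text \<open>
  The index \<open>Inl n\<close> stands for the class of \<open>b\<^sup>n\<close>, and the indices \<open>Inr j\<close> for a basis of \<open>V\<close>
  consisting of eigenvectors \<open>e\<^sub>j\<close> of \<open>ab\<close> with eigenvalues \<open>q\<^sup>j\<close>, where \<open>e\<^sub>0\<close> is the class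
  of \<open>a - 1\<close> and \<open>b e\<^sub>j = e\<^sub>j\<^sub>+\<^sub>1\<close>.
\<close>

definition M_alpha :: "'k::field \<Rightarrow> (nat + int \<Rightarrow> 'k) \<Rightarrow> nat + int \<Rightarrow> 'k" where
  "M_alpha q p = (\<lambda>i. case i of Inl n \<Rightarrow> q ^ n * p (Inl n)
    | Inr j \<Rightarrow> q powi j * (p (Inr (j + 1)) + (if j \<ge> 0 then p (Inl (nat j)) else 0)))"

definition M_beta :: "(nat + int \<Rightarrow> 'k::field) \<Rightarrow> nat + int \<Rightarrow> 'k" where
  "M_beta p = (\<lambda>i. case i of Inl n \<Rightarrow> (case n of 0 \<Rightarrow> 0 | Suc m \<Rightarrow> p (Inl m))
    | Inr j \<Rightarrow> p (Inr (j - 1)))"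

text \<open>\<open>M_alpha\<close> is the action of a on coefficients: the coefficient of e_j in a p
  collects those of e_(j+1) and, for j \<ge> 0, of b^j in p, both with the factor q^j.\<close>

lemma qp_operators_M:
  assumes "q \<noteq> 0"
  shows "qp_operators q (M_alpha q) M_beta"
proof
  fix f :: "nat + int \<Rightarrow> 'a"
  have "M_alpha q (M_beta f) (Inr j) = q * M_beta (M_alpha q f) (Inr j)" for j
  proof -
    have "q powi j = q * q powi (j - 1)"
      using assms by (simp add: power_int_diff)
    \<comment> \<open>At j = 0 the term from b^j vanishes on both sides: on the left
      \<open>M_beta\<close> is zero at \<open>Inl 0\<close>, on the right the shifted index j - 1 is
      negative.\<close>
    moreover have "(case nat j of 0 \<Rightarrow> 0 | Suc m \<Rightarrow> f (Inl m)) = f (Inl (nat (j - 1)))" if pos: "j > 0"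
    proof -
      obtain m where "j = int (Suc m)"
        using zero_less_imp_eq_int[OF pos] by (metis Suc_pred)
      then show ?thesis
        by (simp del: of_nat_Suc) simp
    qed
    ultimately show ?thesis
      by (auto simp: M_alpha_def M_beta_def)
  qed
  moreover have "M_alpha q (M_beta f) (Inl n) = q * M_beta (M_alpha q f) (Inl n)" for n
    by (simp add: M_alpha_def M_beta_def split: nat.splits)
  ultimately show "M_alpha q (M_beta f) = (\<lambda>i. q * M_beta (M_alpha q f) i)"
    by (intro ext) (metis sumE)
qed (auto simp: M_alpha_def M_beta_def algebra_simps fun_eq_iff split: nat.splits sum.splits)

text \<open>The spanning half for M: \<open>w\<close> and \<open>e\<close> stand for the classes of
  1 and a - 1, and only relations between them are assumed, no independence.\<close>

locale M_generators = qp_module q M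
  for q :: "'k::field" and M :: "((qp_gen list \<Rightarrow> 'k) set, 'm, 'd) module_scheme" (structure) +
  fixes w e
  assumes q_nonzero: "q \<noteq> 0" and w [simp]: "w \<in> carrier M"
    and e_def: "e = act_a w \<ominus> w" and a_b_e: "act_a (act_b e) = e"
    and gen: "\<And>x. x \<in> carrier M \<Longrightarrow> \<exists>r\<in>carrier (quantum_plane q). x = r \<odot> w"
begin

lemma e_closed [simp]: "e \<in> carrier M"
  by (simp add: e_def)

text \<open>\<open>e_neg m\<close> is e_(-m). The factor inverts q^(-m-1) in a e_(-m) = q^(-m-1)
  e_(-m-1), so that b shifts the index without a scalar.\<close>

fun e_neg :: "nat \<Rightarrow> 'm" where
  "e_neg 0 = e"
| "e_neg (Suc m) = scal (q ^ Suc m) (act_a (e_neg m))"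

fun M_basis :: "nat + int \<Rightarrow> 'm" where
  "M_basis (Inl n) = (act_b ^^ n) w"
| "M_basis (Inr j) = (if j \<ge> 0 then (act_b ^^ nat j) e else e_neg (nat (- j)))"

lemma closed [simp]: "(act_b ^^ n) w \<in> carrier M" "(act_b ^^ n) e \<in> carrier M" "e_neg n \<in> carrier M"
  by (induction n) auto

lemma M_basis_closed [simp]: "M_basis i \<in> carrier M"
  by (cases i) auto

lemma act_a_w: "act_a w = w \<oplus> e"
proof -
  have "e \<oplus> w = act_a w"
    by (simp add: e_def M.minus_eq M.a_assoc M.l_neg)
  then show ?thesis
    by (simp add: M.a_comm)
qed

lemma act_a_pow_w: "act_a ((act_b ^^ n) w) = scal (q ^ n) ((act_b ^^ n) w \<oplus> (act_b ^^ n) e)"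
proof (induction n)
  case 0
  show ?case
    by (simp add: act_a_w)
next
  case (Suc n)
  then show ?case
    by (simp add: act_a_act_b act_scal scal_scal act_add)
qed

lemma act_a_pow_e: "act_a ((act_b ^^ Suc n) e) = scal (q ^ n) ((act_b ^^ n) e)"
proof (induction n)
  case (Suc n)
  have "act_a ((act_b ^^ Suc (Suc n)) e) = scal q (act_b (act_a ((act_b ^^ Suc n) e)))"
    using act_a_act_b[OF closed(2), of "Suc n"] by simp
  then show ?case
    by (simp only: Suc) (simp add: act_scal scal_scal)
qed (simp add: a_b_e)

lemma act_b_e_neg: "act_b (e_neg (Suc m)) = e_neg m"
proof -
  have step: "act_b (e_neg (Suc m)) = scal (q ^ m) (act_a (act_b (e_neg m)))" for m
    by (simp add: act_scal act_a_act_b scal_scal mult.commute)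
  \<comment> \<open>That is, ab has eigenvalue q^(-m) on e_(-m). Inductively b e_(-m-1) = e_(-m),
    and applying q^(m+1) a to this returns e_(-m-1).\<close>
  have "scal (q ^ m) (act_a (act_b (e_neg m))) = e_neg m"
    by (induction m) (simp_all only: step, simp_all add: a_b_e)
  then show ?thesis
    using step by simp
qed

lemma lin_span_M: "lin_span M_basis = carrier M"
proof (rule lin_span_eq_carrier[OF M_basis_closed _ gen])
  note span = lin_span_u[of M_basis, OF M_basis_closed] lin_span_scal_u[of M_basis, OF M_basis_closed]
    lin_span_add[of M_basis, OF M_basis_closed] lin_span_scal[of M_basis, OF M_basis_closed]
  show "w \<in> lin_span M_basis"
    using span(1)[of "Inl 0"] by simp
  have w: "(act_b ^^ n) w \<in> lin_span M_basis" for n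
    using span(1)[of "Inl n"] by simp
  have e: "(act_b ^^ n) e \<in> lin_span M_basis" for n
    using span(1)[of "Inr (int n)"] by simp
  have e_neg: "e_neg n \<in> lin_span M_basis" for n
    using span(1)[of "Inr (- int n)"] by (cases "n = 0") (auto simp del: e_neg.simps(2))
  have a_e_neg: "act_a (e_neg m) \<in> lin_span M_basis" for m
  proof -
    have "act_a (e_neg m) = scal (inverse (q ^ Suc m)) (e_neg (Suc m))"
      using q_nonzero by (simp add: scal_scal del: power_Suc)
    then show ?thesis
      using span(4)[OF e_neg] by metis
  qed
  show "act_a (M_basis i) \<in> lin_span M_basis" for i
  proof (cases i)
    case (Inl n)
    then show ?thesis
      by (simp add: act_a_pow_w span w e)
  next
    case (Inr j)
    show ?thesis
    proof (cases "j > 0")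
      case True
      then obtain n where "j = int (Suc n)"
        using zero_less_imp_eq_int[of j] by (metis Suc_pred)
      then show ?thesis
        using Inr act_a_pow_e[of n] span(4)[OF e] by (simp del: of_nat_Suc)
    next
      \<comment> \<open>The index 0 falls under this case, where the basis vector is
        \<open>e\<close>, that is \<open>e_neg 0\<close>.\<close>
      case False
      then show ?thesis
        using Inr a_e_neg a_e_neg[of 0] by simp
    qed
  qed
  show "act_b (M_basis i) \<in> lin_span M_basis" for i
  proof (cases i)
    case (Inl n)
    then show ?thesis
      using w[of "Suc n"] by simp
  next
    case (Inr j)
    show ?thesis
    proof (cases "j \<ge> 0")
      case True
      then show ?thesis
        using Inr e[of "Suc (nat j)"] by simp
    next
      case False
      then obtain n where "j = - int (Suc n)"
        by (metis int_cases2 of_nat_0_le_iff negD not_le)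
      then show ?thesis
        using Inr act_b_e_neg[of n] e_neg by (simp del: of_nat_Suc e_neg.simps)
    qed
  qed
qed

lemma M_model:
  assumes h: "h \<in> module_hom (quantum_plane q) M (qp_operators.function_module (M_alpha q) M_beta)"
    and hw: "h w = (\<lambda>i. if i = Inl 0 then 1 else 0)"
  shows "qp_model q M (M_alpha q) M_beta h M_basis"
proof -
  interpret op: qp_operators q "M_alpha q" M_beta by (rule qp_operators_M) (rule q_nonzero)
  have h_add: "h (x \<oplus> y) = (\<lambda>i. h x i + h y i)" if "x \<in> carrier M" "y \<in> carrier M" for x y
    using h that by (simp add: module_hom_def)
  have h_act: "h (act_a x) = M_alpha q (h x)" "h (act_b x) = M_beta (h x)"
    "h (scal c x) = (\<lambda>i. c * h x i)" if "x \<in> carrier M" for c x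
    using h that by (simp_all add: module_hom_def act_a_def act_b_def scal_def op.function_module_act)
  \<comment> \<open>Since a w = w + e, the coordinates of \<open>e\<close> are
    \<open>M_alpha\<close> of the delta function at \<open>Inl 0\<close> minus that delta
    function.\<close>
  have he: "M_alpha q (h w) = (\<lambda>i. h w i + h e i)"
    by (simp flip: h_add h_act add: act_a_w)
  have he: "h e = (\<lambda>i. if i = Inr 0 then 1 else 0)"
  proof
    fix i
    have "h e i = M_alpha q (h w) i - h w i"
      unfolding he by simp
    then show "h e i = (if i = Inr 0 then 1 else 0)"
      by (auto simp: hw M_alpha_def split: sum.splits)
  qed
  have "h (e_neg n) = (\<lambda>i. if i = Inr (- int n) then 1 else 0)" for n
  proof (induction n)
    case (Suc n)
    \<comment> \<open>\<open>M_alpha\<close> moves the delta at -n to j = -n - 1 with the factor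
      q^j, which the factor in \<open>e_neg\<close> cancels.\<close>
    have "q ^ Suc n * q powi j = 1" if "j + 1 = - int n" for j
    proof -
      have "j = - int (Suc n)" using that by simp
      then show ?thesis
        using q_nonzero by (simp add: power_int_minus del: of_nat_Suc power_Suc)
    qed
    then show ?case
      by (auto simp: h_act Suc M_alpha_def fun_eq_iff simp del: power_Suc split: sum.splits)
  qed (simp add: he)
  moreover have "h ((act_b ^^ n) e) = (\<lambda>i. if i = Inr (int n) then 1 else 0)" for n
    by (induction n) (auto simp: he h_act M_beta_def fun_eq_iff split: sum.splits nat.splits)
  moreover have "h ((act_b ^^ n) w) = (\<lambda>i. if i = Inl n then 1 else 0)" for n
    by (induction n) (auto simp: hw h_act M_beta_def fun_eq_iff split: sum.splits nat.splits)
  ultimately have "h (M_basis i) = (\<lambda>j. if j = i then 1 else 0)" for i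
    by (cases i) auto
  then show ?thesis
    by (intro op.qp_modelI qp_module_axioms h lin_span_M) auto
qed

end

locale M_model = qp_model q M "M_alpha q" M_beta h u
  for q :: "'k::field" and M :: "((qp_gen list \<Rightarrow> 'k) set, 'm, 'd) module_scheme" (structure) and h u +
  assumes q_nonzero: "q \<noteq> 0" and q_non_root: "\<forall>n>0. q ^ n \<noteq> 1"
begin

text \<open>This is \<open>V\<close> in coordinates. The name is justified by
  \<open>simple_socle\<close> and \<open>essential_socle\<close>.\<close>

definition socle :: "'m set" where
  "socle = {x \<in> carrier M. \<forall>n. h x (Inl n) = 0}"

lemma submodule_socle: "submodule socle (quantum_plane q) M"
  by (rule qp_submoduleI)
    (auto simp: socle_def h_add h_scal h_a h_b M_alpha_def M_beta_def split: nat.splits)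

lemma socle_subset_iff:
  assumes N: "submodule N (quantum_plane q) M"
  shows "socle \<subseteq> N \<longleftrightarrow> (\<forall>j. u (Inr j) \<in> N)"
proof
  assume u: "\<forall>j. u (Inr j) \<in> N"
  have "u i \<in> N" if "x \<in> socle" "h x i \<noteq> 0" for x i
    using u that by (cases i) (auto simp: socle_def)
  then show "socle \<subseteq> N"
    using mem_submoduleI[OF N] by (auto simp: socle_def)
qed (auto simp: socle_def h_u)

lemma act_a_u: "act_a (u (Inr j)) = scal (q powi (j - 1)) (u (Inr (j - 1)))"
  by (subst h_inject[symmetric]) (auto simp: h_a h_scal h_u M_alpha_def split: sum.splits)

lemma act_b_u: "act_b (u (Inr j)) = u (Inr (j + 1))"
  by (subst h_inject[symmetric]) (auto simp: h_b h_u M_beta_def split: sum.splits nat.splits)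

text \<open>From one e_i, b reaches all higher indices and a all lower ones, up to powers of q,
  which are invertible.\<close>

lemma socle_subset:
  assumes N: "submodule N (quantum_plane q) M" and u: "u (Inr i) \<in> N"
  shows "socle \<subseteq> N"
proof -
  note N' = qp_submoduleD[OF N]
  have "u (Inr j) \<in> N" for j
  proof (induction j rule: int_induct[of _ i])
    case (step1 j)
    then show ?case
      using N'(3)[of "u (Inr j)"] by (simp add: act_b_u)
  next
    case (step2 j)
    have "u (Inr (j - 1)) = scal (inverse (q powi (j - 1))) (act_a (u (Inr j)))"
      using q_nonzero by (simp add: act_a_u scal_scal)
    then show ?case
      using N' step2.IH by metis
  qed (rule u)
  then show ?thesis
    using socle_subset_iff[OF N] by simp
qed

lemma simple_socle: "simple_module (quantum_plane q) (M\<lparr>carrier := socle\<rparr>)"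
  unfolding simple_module_def
proof (intro conjI allI impI)
  show "left_module (quantum_plane q) (M\<lparr>carrier := socle\<rparr>)"
    by (rule left_module_submodule) (rule submodule_socle)
  have "u (Inr 0) \<in> socle"
    by (simp add: socle_def h_u)
  moreover have "u (Inr 0) \<noteq> \<zero>"
    using h_u[of "Inr 0"] by (auto dest: fun_cong[of _ _ "Inr 0"])
  ultimately show "carrier (M\<lparr>carrier := socle\<rparr>) \<noteq> {\<zero>\<^bsub>M\<lparr>carrier := socle\<rparr>\<^esub>}"
    by auto
  fix N assume N: "submodule N (quantum_plane q) (M\<lparr>carrier := socle\<rparr>)"
  note sub = submodule_of_submodule[OF submodule_socle N]
  note N' = submoduleD[OF sub(1)] qp_submoduleD[OF sub(1)]
  have "N = socle" if ne: "N \<noteq> {\<zero>}"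
  proof -
    obtain x where x: "x \<in> N" "x \<noteq> \<zero>"
      using ne N'(2) by blast
    then obtain i where i: "h x i \<noteq> 0"
      using h_eq_zero_iff[of x] N'(1) by blast
    moreover have "h x (Inl n) = 0" for n
      using x sub(2) by (auto simp: socle_def)
    ultimately obtain j where j: "i = Inr j"
      by (cases i) auto
    \<comment> \<open>With vanishing \<open>Inl\<close> coordinates, ab is diagonal on the
      \<open>Inr\<close> coordinates, with eigenvalue q^j at \<open>Inr j\<close>.\<close>
    obtain y where y: "y \<in> N" "\<And>k. k \<in> range Inr \<Longrightarrow> h y k = (if k = i then 1 else 0)"
    proof (rule isolate_eigencomponent[OF sub(1), of "\<lambda>x. act_a (act_b x)" "range Inr" "\<lambda>i. q powi (projr i)" x i])
      show "h (act_a (act_b x)) k = q powi projr k * h x k" if "x \<in> N" "k \<in> range Inr" for x k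
        using that sub(2)
        by (auto simp: h_a h_b M_alpha_def M_beta_def socle_def subset_iff split: nat.splits)
      show "inj_on (\<lambda>i. q powi projr i) (range Inr)"
        using inj_power_int_non_root[OF q_nonzero q_non_root] by (auto simp: inj_on_def)
    qed (use N' x i j in auto)
    have "h y k = (if k = i then 1 else 0)" for k
      using y sub(2) j by (cases k) (auto simp: socle_def)
    then have "h y = h (u i)"
      by (auto simp: h_u)
    then have "u i \<in> N"
      using y(1) N'(1) h_inject[of y "u i"] by auto
    then show ?thesis
      using socle_subset[OF sub(1)] sub(2) j by blast
  qed
  then show "N = {\<zero>\<^bsub>M\<lparr>carrier := socle\<rparr>\<^esub>} \<or> N = carrier (M\<lparr>carrier := socle\<rparr>)"
    by auto
qed

text \<open>
  A submodule meeting \<open>V\<close> trivially would contain an element \<open>b\<^sup>n + v\<close> with \<open>v \<in> V\<close> on which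
  \<open>a\<close> acts as \<open>q\<^sup>n\<close>.  This determines the coefficients of \<open>v\<close> recursively and forces
  infinitely many of them to be nonzero.
\<close>

lemma no_eigenvector:
  assumes y: "y \<in> carrier M" and eig: "act_a y = scal (q ^ n) y"
    and yl: "\<And>m. h y (Inl m) = (if m = n then 1 else 0)"
  shows False
proof -
  let ?v = "\<lambda>j. h y (Inr j)"
  \<comment> \<open>The coordinate at \<open>Inr j\<close> of the eigenvalue equation; b^n
    contributes to it only for j = n.\<close>
  have rec: "q powi j * (?v (j + 1) + (if j = int n then 1 else 0)) = q ^ n * ?v j" for j
  proof -
    have "M_alpha q (h y) (Inr j) = q ^ n * ?v j"
      using y by (simp flip: h_a add: eig h_scal)
    then show ?thesis
      by (cases "j = int n") (auto simp: M_alpha_def yl split: if_splits)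
  qed
  \<comment> \<open>The recursion links neighbours except across the gap from n to n + 1, so each
    half-line is either all zero or nowhere zero; finite support leaves zero.\<close>
  have iff: "?v (j + 1) = 0 \<longleftrightarrow> ?v j = 0" if "j \<noteq> int n" for j
    using rec[of j] that q_nonzero by auto
  have fin: "finite {j. ?v j \<noteq> 0}"
    using finite_vimageI[OF finite_support[OF y], of Inr] by (simp add: vimage_def)
  have up: "?v (int n + 1) = 0"
  proof (rule ccontr)
    assume *: "?v (int n + 1) \<noteq> 0"
    have "?v j \<noteq> 0" if "int n + 1 \<le> j" for j
      using that by (induction j rule: int_ge_induct) (use * iff in auto)
    then have "{int n + 1..} \<subseteq> {j. ?v j \<noteq> 0}"
      by auto
    then show False
      using fin infinite_Ici finite_subset by blast
  qed
  have down: "?v (int n) = 0"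
  proof (rule ccontr)
    assume *: "?v (int n) \<noteq> 0"
    have "?v j \<noteq> 0" if "j \<le> int n" for j
      using that
    proof (induction j rule: int_le_induct)
      case (step j)
      then show ?case
        using iff[of "j - 1"] by simp
    qed (rule *)
    then have "{..int n} \<subseteq> {j. ?v j \<noteq> 0}"
      by auto
    then show False
      using fin infinite_Iic finite_subset by blast
  qed
  \<comment> \<open>At j = n the recursion reads v_(n+1) + 1 = v_n.\<close>
  show False
    using rec[of "int n"] up down q_nonzero by simp
qed

lemma essential_socle: "essential_extension (quantum_plane q) M socle"
  unfolding essential_extension_def
proof (intro conjI allI impI)
  fix N assume "submodule N (quantum_plane q) M \<and> N \<noteq> {\<zero>}"
  then have N: "submodule N (quantum_plane q) M" and ne: "N \<noteq> {\<zero>}"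
    by auto
  note N' = submoduleD[OF N] qp_submoduleD[OF N]
  show "N \<inter> socle \<noteq> {\<zero>}"
  proof
    assume int: "N \<inter> socle = {\<zero>}"
    obtain x where x: "x \<in> N" "x \<noteq> \<zero>"
      using ne N'(2) by blast
    then obtain n where n: "h x (Inl n) \<noteq> 0"
      using int N'(1) by (auto simp: socle_def)
    \<comment> \<open>Modulo V the operator a is diagonal on the classes of b^k, hence the
      restriction to the \<open>Inl\<close> coordinates: \<open>y\<close> is b^n plus an element of
      V.\<close>
    obtain y where y: "y \<in> N" "\<And>k. k \<in> range Inl \<Longrightarrow> h y k = (if k = Inl n then 1 else 0)"
    proof (rule isolate_eigencomponent[OF N, of act_a "range Inl" "\<lambda>i. q ^ projl i" x "Inl n"])
      show "h (act_a x) k = q ^ projl k * h x k" if "x \<in> N" "k \<in> range Inl" for x k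
        using that N'(1) by (auto simp: h_a M_alpha_def subset_iff)
      show "inj_on (\<lambda>i. q ^ projl i) (range Inl)"
        using inj_power_non_root[OF q_nonzero q_non_root] by (auto simp: inj_on_def)
    qed (use N' x n in auto)
    have yM: "y \<in> carrier M"
      using y N' by auto
    \<comment> \<open>The \<open>Inl\<close> coordinates cancel, which places the difference in the
      intersection and makes it zero.\<close>
    have "act_a y \<ominus> scal (q ^ n) y \<in> N \<inter> socle"
      using y N' yM by (auto simp: socle_def h_minus h_a h_scal M_alpha_def)
    then have "act_a y = scal (q ^ n) y"
      using int yM by (simp add: M.minus_eq_zero_iff)
    then show False
      by (rule no_eigenvector[OF yM]) (use y(2) in auto)
  qed
qed (rule left_module_axioms submodule_socle)+

lemma not_artinian: "\<not> artinian_module (quantum_plane q) M"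
proof
  assume art: "artinian_module (quantum_plane q) M"
  \<comment> \<open>The preimage of b^n K[b] under the projection to W; the class of b^n witnesses
    strictness.\<close>
  define S where "S n = {x \<in> carrier M. \<forall>k<n. h x (Inl k) = 0}" for n
  have "submodule (S n) (quantum_plane q) M" for n
    by (rule qp_submoduleI)
      (auto simp: S_def h_add h_scal h_a h_b M_alpha_def M_beta_def split: nat.splits)
  moreover have "S (Suc n) \<subseteq> S n" for n
    by (auto simp: S_def)
  ultimately obtain n where "\<forall>m\<ge>n. S m = S n"
    using art unfolding artinian_module_def by blast
  then have "S (Suc n) = S n"
    using le_SucI by blast
  moreover have "u (Inl n) \<in> S n" "u (Inl n) \<notin> S (Suc n)"
    by (auto simp: S_def h_u)
  ultimately show False
    by simp
qed

end

theorem theorem3p1: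
  fixes q :: "'k::field"
  assumes q_nonzero: "q \<noteq> 0"
    and q_not_root_of_unity: "\<forall>n>0. q ^ n \<noteq> 1"
    and B: "B = quantum_plane q"
    and a: "a = qp_a q"
    and b: "b = qp_b q"
    and I: "I = principal_left_ideal B ((a \<otimes>\<^bsub>B\<^esub> b \<ominus>\<^bsub>B\<^esub> \<one>\<^bsub>B\<^esub>) \<otimes>\<^bsub>B\<^esub> (a \<ominus>\<^bsub>B\<^esub> \<one>\<^bsub>B\<^esub>))"
    and J: "J = principal_left_ideal B (a \<ominus>\<^bsub>B\<^esub> \<one>\<^bsub>B\<^esub>)"
    and M: "M = quotient_module (regular_module B) I"
    and V: "V = {I +>\<^bsub>B\<^esub> x | x. x \<in> J}"
    and W: "W = quotient_module (regular_module B) J"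
  shows "simple_module B (M\<lparr>carrier := V\<rparr>) \<and>
         \<not> artinian_module B M \<and> essential_extension B M V \<and>
         (\<forall>N N'. submodule N B W \<and> submodule N' B W \<longrightarrow> N \<subseteq> N' \<or> N' \<subseteq> N) \<and>
         (\<forall>N N'. submodule N B W \<and> submodule N' B W \<and> N \<noteq> N' \<longrightarrow>
            \<not> isomorphic_modules B (W\<lparr>carrier := N\<rparr>) (W\<lparr>carrier := N'\<rparr>))"
proof -
  interpret B: ring B
    unfolding B by (rule ring_quantum_plane)
  have ab [simp]: "a \<in> carrier B" "b \<in> carrier B"
    by (simp_all add: a b B)
  let ?x = "a \<ominus>\<^bsub>B\<^esub> \<one>\<^bsub>B\<^esub>"
  let ?y = "a \<otimes>\<^bsub>B\<^esub> b \<ominus>\<^bsub>B\<^esub> \<one>\<^bsub>B\<^esub>"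
  have z: "?y \<otimes>\<^bsub>B\<^esub> ?x \<in> carrier B"
    by simp
  interpret J: left_ideal_quotient B J
    unfolding J by (rule principal_left_ideal_quotient) (simp_all add: B.ring_axioms)
  interpret I: left_ideal_quotient B I
    unfolding I by (rule principal_left_ideal_quotient) (simp_all add: B.ring_axioms)

  \<comment> \<open>Coordinates on W\<close>
  interpret W: qp_module q W
    unfolding W B[symmetric] by (intro qp_module.intro) (use J.quo.left_module_axioms B in simp)
  interpret oW: qp_operators q "W_alpha q" W_beta by (rule qp_operators_W)
  interpret FW: left_module B oW.function_module
    unfolding B by (rule oW.left_module_function_module)
  interpret WB: left_module B W
    unfolding W by (rule J.quo.left_module_axioms)
  have x_W: "?x \<odot>\<^bsub>W\<^esub> (J +>\<^bsub>B\<^esub> \<one>\<^bsub>B\<^esub>) = \<zero>\<^bsub>W\<^esub>"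
  proof -
    have "?x \<in> J"
      unfolding J principal_left_ideal_def by (force intro!: exI[of _ "\<one>\<^bsub>B\<^esub>"])
    then show ?thesis
      by (simp add: W J.smult_quotient J.coset_eq_zero_iff J.zero_quotient)
  qed
  obtain hW where hW: "hW \<in> module_hom B W oW.function_module"
    and hW1: "\<And>r. r \<in> carrier B \<Longrightarrow> hW (J +>\<^bsub>B\<^esub> r) = r \<odot>\<^bsub>oW.function_module\<^esub> (\<lambda>n. if n = 0 then 1 else 0)"
    unfolding W J
  proof (rule principal_quotient_hom_exists[OF FW.left_module_axioms, of ?x "\<lambda>n. if n = 0 then 1 else 0"])
    show "?x \<odot>\<^bsub>oW.function_module\<^esub> (\<lambda>n. if n = 0 then 1 else 0) = \<zero>\<^bsub>oW.function_module\<^esub>"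
      by (simp add: FW.smult_diff_left oW.function_module_minus)
        (auto simp: a oW.function_module_act W_alpha_def)
  qed auto
  have "qp_model q W (W_alpha q) W_beta hW (\<lambda>n. (W.act_b ^^ n) (J +>\<^bsub>B\<^esub> \<one>\<^bsub>B\<^esub>))"
  proof (rule W_model_exists[OF W.qp_module_axioms])
    show "J +>\<^bsub>B\<^esub> \<one>\<^bsub>B\<^esub> \<in> carrier W"
      by (auto simp: W J.carrier_quotient)
    then show "qp_a q \<odot>\<^bsub>W\<^esub> (J +>\<^bsub>B\<^esub> \<one>\<^bsub>B\<^esub>) = J +>\<^bsub>B\<^esub> \<one>\<^bsub>B\<^esub>"
      using x_W unfolding a[symmetric] by (simp add: WB.smult_diff_left W.M.minus_eq_zero_iff)
    show "hW \<in> module_hom (quantum_plane q) W oW.function_module"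
      using hW unfolding B .
    show "hW (J +>\<^bsub>B\<^esub> \<one>\<^bsub>B\<^esub>) = (\<lambda>n. if n = 0 then 1 else 0)"
      by (simp add: hW1)
    show "\<exists>r\<in>carrier (quantum_plane q). X = r \<odot>\<^bsub>W\<^esub> (J +>\<^bsub>B\<^esub> \<one>\<^bsub>B\<^esub>)" if "X \<in> carrier W" for X
      using J.quotient_generator that unfolding W B by blast
  qed
  then interpret W: W_model q W hW "\<lambda>n. (W.act_b ^^ n) (J +>\<^bsub>B\<^esub> \<one>\<^bsub>B\<^esub>)"
    using q_nonzero q_not_root_of_unity by (intro W_model.intro W_model_axioms.intro)

  \<comment> \<open>Coordinates on M\<close>
  let ?w = "I +>\<^bsub>B\<^esub> \<one>\<^bsub>B\<^esub>" and ?e = "I +>\<^bsub>B\<^esub> ?x"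
  interpret M: qp_module q M
    unfolding M B[symmetric] by (intro qp_module.intro) (use I.quo.left_module_axioms B in simp)
  interpret oM: qp_operators q "M_alpha q" M_beta by (rule qp_operators_M) (rule q_nonzero)
  interpret FM: left_module B oM.function_module
    unfolding B by (rule oM.left_module_function_module)
  interpret MB: left_module B M
    unfolding M by (rule I.quo.left_module_axioms)
  have w: "?w \<in> carrier M" and e: "?e \<in> carrier M"
    by (auto simp: M I.carrier_quotient)
  have e_eq: "?e = M.act_a ?w \<ominus>\<^bsub>M\<^esub> ?w"
  proof -
    have "?e = ?x \<odot>\<^bsub>M\<^esub> ?w"
      by (simp add: M I.smult_quotient)
    also have "\<dots> = a \<odot>\<^bsub>M\<^esub> ?w \<ominus>\<^bsub>M\<^esub> ?w"
      using w by (simp add: MB.smult_diff_left)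
    finally show ?thesis
      by (simp add: M.act_a_def a)
  qed
  have ab_e: "M.act_a (M.act_b ?e) = ?e"
  proof -
    have "?y \<otimes>\<^bsub>B\<^esub> ?x \<in> I"
      unfolding I principal_left_ideal_def by (force intro!: exI[of _ "\<one>\<^bsub>B\<^esub>"])
    then have "?y \<odot>\<^bsub>M\<^esub> ?e = \<zero>\<^bsub>M\<^esub>"
      by (simp add: M I.smult_quotient I.coset_eq_zero_iff I.zero_quotient)
    moreover have "?y \<odot>\<^bsub>M\<^esub> ?e = a \<odot>\<^bsub>M\<^esub> (b \<odot>\<^bsub>M\<^esub> ?e) \<ominus>\<^bsub>M\<^esub> ?e"
      using e by (simp add: MB.smult_diff_left MB.smult_assoc)
    ultimately show ?thesis
      using e M.M.minus_eq_zero_iff[of "M.act_a (M.act_b ?e)" ?e]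
      by (simp add: M.act_a_def M.act_b_def a b)
  qed
  interpret G: M_generators q M ?w ?e
  proof unfold_locales
    show "\<exists>r\<in>carrier (quantum_plane q). X = r \<odot>\<^bsub>M\<^esub> ?w" if "X \<in> carrier M" for X
      using I.quotient_generator that unfolding M B by blast
  qed (fact q_nonzero w e_eq ab_e)+
  obtain hM where hM: "hM \<in> module_hom B M oM.function_module"
    and hM1: "\<And>r. r \<in> carrier B \<Longrightarrow> hM (I +>\<^bsub>B\<^esub> r) = r \<odot>\<^bsub>oM.function_module\<^esub> (\<lambda>i. if i = Inl 0 then 1 else 0)"
    unfolding M I
  proof (rule principal_quotient_hom_exists[OF FM.left_module_axioms z, of "\<lambda>i. if i = Inl 0 then 1 else 0"])
    let ?v = "\<lambda>i. if i = Inl 0 then 1 else 0"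
    \<comment> \<open>The delta at \<open>Inl 0\<close> plays the class of 1, so a - 1 must send it
      to the delta of e_0.\<close>
    have "?x \<odot>\<^bsub>oM.function_module\<^esub> ?v = (\<lambda>i. if i = Inr 0 then 1 else 0)"
      by (simp add: FM.smult_diff_left oM.function_module_minus)
        (auto simp: a oM.function_module_act M_alpha_def fun_eq_iff split: sum.splits)
    \<comment> \<open>Here b moves the delta from \<open>Inr 0\<close> to \<open>Inr 1\<close>, and
      a moves it back with the factor q^0 = 1.\<close>
    moreover have "?y \<odot>\<^bsub>oM.function_module\<^esub> (\<lambda>i. if i = Inr 0 then 1 else 0) = (\<lambda>i. 0)"
      by (simp add: FM.smult_diff_left oM.function_module_minus FM.smult_assoc)
        (auto simp: a b oM.function_module_act M_alpha_def M_beta_def fun_eq_iff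
          split: sum.splits nat.splits)
    ultimately show "?y \<otimes>\<^bsub>B\<^esub> ?x \<odot>\<^bsub>oM.function_module\<^esub> ?v = \<zero>\<^bsub>oM.function_module\<^esub>"
      by (simp add: FM.smult_assoc)
  qed auto
  have "qp_model q M (M_alpha q) M_beta hM G.M_basis"
    by (rule G.M_model[OF hM[unfolded B]]) (simp add: hM1)
  then interpret M: M_model q M hM G.M_basis
    using q_nonzero q_not_root_of_unity by (intro M_model.intro M_model_axioms.intro)

  \<comment> \<open>Identification of V with the socle\<close>
  have V_cyclic: "V = {r \<odot>\<^bsub>M\<^esub> ?e | r. r \<in> carrier B}"
  proof -
    have "r \<odot>\<^bsub>M\<^esub> ?e = I +>\<^bsub>B\<^esub> (r \<otimes>\<^bsub>B\<^esub> ?x)" if "r \<in> carrier B" for r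
      using that by (simp add: M I.smult_quotient)
    then show ?thesis
      unfolding V J principal_left_ideal_def by blast
  qed
  have "V = M.socle"
  proof
    have "?e \<in> M.socle"
      using e M.h_u[of "Inr 0"] by (simp add: M.socle_def)
    then show "V \<subseteq> M.socle"
      using M.submoduleD(4)[OF M.submodule_socle] by (auto simp: V_cyclic B)
    have "submodule V (quantum_plane q) M"
      using M.submodule_cyclic[OF e] by (simp add: V_cyclic B)
    \<comment> \<open>This basis vector is the class of a - 1, and a single basis vector of the
      socle suffices.\<close>
    moreover have "G.M_basis (Inr 0) \<in> V"
      using MB.smult_one[OF e] unfolding V_cyclic by (force intro!: exI[of _ "\<one>\<^bsub>B\<^esub>"])
    ultimately show "M.socle \<subseteq> V"
      by (rule M.socle_subset)
  qed
  then show ?thesis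
    using M.simple_socle M.not_artinian M.essential_socle
      W.submodules_linear W.isomorphic_submodules_eq
    unfolding B by blast
qed

end
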